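(* Let $\varphi:\Sigma^*\to\Sigma^*$ be a primitive morphism having an aperiodic infinite fixed point, let $L=L_\varphi$ be its subshift, and suppose that $L$ is separable and that $\varphi$ is order-preserving on $L$. Let $f$ be the morphism on the extended interval $X_L$ associated with $\varphi$. Then for every $w\in L$, $$f(\nu_w)=\nu_{\varphi(w)},$$ where $\nu_w,\nu_{\varphi(w)}\in X_L^{\omega}$ are the equidistributed sequences corresponding to $w$ and to $\varphi(w)$.
   Context: Words and subshifts. $\Sigma=\{a_1,\dots,a_q\}$ is a finite alphabet with $a_1<\dots<a_q$; finite and infinite words (indexed from $0$) are ordered lexicographically, and $\sigma$ is the shift erasing the first symbol. A morphism preserves concatenation and also acts on infinite words. $\varphi$ is primitive if for some $n$ every letter occurs in $\varphi^n(b)$ for every letter $b$; $\theta$ is the Perron-Frobenius eigenvalue of its matrix. $L=L_\varphi$ is the closure of the $\sigma$-orbit of an infinite fixed point of $\varphi$ (independent of the fixed point for primitive $\varphi$). It is minimal and uniquely ergodic with shift-invariant probability measure $\mu$. An infinite word is aperiodic if it is not ultimately periodic. $\varphi$ is order-preserving on $L$ if for all $u,v\in L$: $u<v$ iff $\varphi(u)<\varphi(v)$. Types. Each $u\in L$ can be written as $u=\sigma^p(\varphi(u'))$ with $u'\in L$, $0\le p<|\varphi(u'[0])|$. If the pair $(u',p)$ is unique, the type of $u$ is $\tau(u)=(u'[0],p)$. $L$ is separable if every $u\in L$ has a type and the $k=\sum_{a\in\Sigma}|\varphi(a)|$ possible types can be totally ordered so that $\tau(u)<\tau(v)$ implies $u<v$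 for all $u,v\in L$. The map $\nu$ and the extended interval. For $v\in L$ let $\nu(v)=\mu(\{x\in L: w_{\min}\le x\le v\})\in[0,1]$, where $w_{\min}$ is the least element of $L$. Words $w_1<w_2$ of $L$ are consecutive if no element of $L$ lies strictly between them; two distinct words of $L$ have the same $\nu$-value exactly when they are consecutive. Let $Z\subset[0,1]$ be the set of values $\nu(w_1)=\nu(w_2)$ over consecutive pairs, and let $X_L=([0,1]\setminus Z)\cup Z^-\cup Z^+$, where each $x\in Z$ is replaced by two copies $x^-<x^+$, both compared with other elements as $x$ is. From now on $\nu$ takes values in $X_L$: for a consecutive pair $w_1<w_2$ with common value $x$ put $\nu(w_1)=x^-$, $\nu(w_2)=x^+$. For $x\in[0,1]\setminus Z$ put $x^-=x^+=x$. For $w\in L$, $\nu_w=(\nu(\sigma^n(w)))_{n\ge 0}\in X_L^\omega$. The morphism $f$. Let $\mu_i$ (also written $\mu_{a_i}$) be the $\mu$-measure of the set of elements of $L$ starting with $a_i$. Let $I_{a_i}=[(\sum_{m<i}\mu_m)^+,(\sum_{m\le i}\mu_m)^-]\subset X_L$, so $I_{a_1}=[0,\mu_1^-]$ and $I_{a_q}=[(1-\mu_q)^+,1]$. List the types in increasing order $\tau_1<\dots<\tau_k$, $\tau_i=(b_i,p_i)$, put $l_i=\mu_{b_i}/\theta$, and let $J_{b_i,p_i}=J_i=[(\sum_{m<i}l_m)^+,(\sum_{m\le i}l_m)^-]\subset X_L$. For $a\in\Sigma$ and $0\le p<|\varphi(a)|$ let $f_{a,p}:I_a\to J_{a,p}$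 be the increasing affine bijection: if $I_a=[x_1^+,x_2^-]$ and $J_{a,p}=[y_1^+,y_2^-]$, then $f_{a,p}(x)=\frac{y_2-y_1}{x_2-x_1}(x-x_1)+y_1$, where elements of $Z^-$ (resp. $Z^+$) are sent to the value with sign $-$ (resp. $+$), and the lower and upper endpoints of $I_a$ are sent to the lower and upper endpoints of $J_{a,p}$. The morphism $f:X_L^*\to X_L^*$ is defined by $f(x)=f_{a,0}(x),\dots,f_{a,|\varphi(a)|-1}(x)$ for $x\in I_a$, and extended to infinite sequences by concatenation. *)

theory Defs
  imports
    "HOL-Probability.Probability"
    "HOL-Library.Fun_Lexorder"
begin

text \<open>
  The ordered alphabet \<open>a\<^sub>1 < \<dots> < a\<^sub>q\<close> is a type of class \<open>finite\<close> and \<open>linorder\<close>.  Infinite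
  words are functions on \<open>nat\<close>, and \<^const>\<open>less_fun\<close> is their strict lexicographic order.
\<close>

definition shift :: "(nat \<Rightarrow> 'b) \<Rightarrow> nat \<Rightarrow> 'b" where
  "shift w = (\<lambda>n. w (Suc n))"

definition lex_le :: "(nat \<Rightarrow> 'a::linorder) \<Rightarrow> (nat \<Rightarrow> 'a) \<Rightarrow> bool" where
  "lex_le u v \<longleftrightarrow> less_fun u v \<or> u = v"

definition morphism :: "('b list \<Rightarrow> 'c list) \<Rightarrow> bool" where
  "morphism h \<longleftrightarrow> (\<forall>u v. h (u @ v) = h u @ h v)"

text \<open>
  The action of a morphism on an infinite word: the letter at position \<open>n\<close> is read off from the
  image of any prefix whose image is long enough.  This is the intended infinite word only if the
  images of the prefixes become arbitrarily long, as is the case for nonerasing morphisms.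
\<close>

definition inf_image :: "('b list \<Rightarrow> 'c list) \<Rightarrow> (nat \<Rightarrow> 'b) \<Rightarrow> nat \<Rightarrow> 'c" where
  "inf_image h w n =
    h (map w [0..<(LEAST m. n < length (h (map w [0..<m])))]) ! n"

definition primitive_morphism :: "('a list \<Rightarrow> 'a list) \<Rightarrow> bool" where
  "primitive_morphism \<phi> \<longleftrightarrow> morphism \<phi> \<and> (\<exists>n. \<forall>a b. a \<in> set ((\<phi> ^^ n) [b]))"

definition ultimately_periodic :: "(nat \<Rightarrow> 'b) \<Rightarrow> bool" where
  "ultimately_periodic w \<longleftrightarrow> (\<exists>p>0. \<exists>N. \<forall>n\<ge>N. w (n + p) = w n)"

abbreviation aperiodic :: "(nat \<Rightarrow> 'b) \<Rightarrow> bool" where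
  "aperiodic w \<equiv> \<not> ultimately_periodic w"

definition incidence_matrix :: "('a::finite list \<Rightarrow> 'a list) \<Rightarrow> complex ^ 'a ^ 'a" where
  "incidence_matrix \<phi> = (\<chi> a b. of_nat (count_list (\<phi> [b]) a))"

definition eigenvalue :: "complex ^ 'n ^ 'n \<Rightarrow> complex \<Rightarrow> bool" where
  "eigenvalue A z \<longleftrightarrow> (\<exists>v. v \<noteq> 0 \<and> A *v v = z *s v)"

text \<open>The real eigenvalue that bounds the modulus of every complex eigenvalue.\<close>

definition perron_frobenius :: "complex ^ 'n ^ 'n \<Rightarrow> real" where
  "perron_frobenius A =
    (THE r. eigenvalue A (complex_of_real r) \<and> (\<forall>z. eigenvalue A z \<longrightarrow> cmod z \<le> r))"

definition orbit_closure :: "(nat \<Rightarrow> 'b) \<Rightarrow> (nat \<Rightarrow> 'b) set" where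
  "orbit_closure w =
    product_topology (\<lambda>_. discrete_topology UNIV) UNIV closure_of {(shift ^^ n) w |n. True}"

definition invariant_prob :: "(nat \<Rightarrow> 'b) set \<Rightarrow> (nat \<Rightarrow> 'b) measure \<Rightarrow> bool" where
  "invariant_prob L \<mu> \<longleftrightarrow>
    prob_space \<mu> \<and>
    sets \<mu> = sets (restrict_space (PiM UNIV (\<lambda>_. count_space UNIV)) L) \<and>
    shift \<in> measurable \<mu> \<mu> \<and> distr \<mu> \<mu> shift = \<mu>"

definition order_preserving_on ::
    "(nat \<Rightarrow> 'a::linorder) set \<Rightarrow> ('a list \<Rightarrow> 'a list) \<Rightarrow> bool" where
  "order_preserving_on L \<phi> \<longleftrightarrow>
    (\<forall>u\<in>L. \<forall>v\<in>L. less_fun u v \<longleftrightarrow> less_fun (inf_image \<phi> u) (inf_image \<phi> v))"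

definition decomposition ::
    "('a list \<Rightarrow> 'a list) \<Rightarrow> (nat \<Rightarrow> 'a) set \<Rightarrow> (nat \<Rightarrow> 'a) \<Rightarrow> (nat \<Rightarrow> 'a) \<times> nat \<Rightarrow> bool" where
  "decomposition \<phi> L u = (\<lambda>(u', p).
    u' \<in> L \<and> p < length (\<phi> [u' 0]) \<and> u = (shift ^^ p) (inf_image \<phi> u'))"

definition has_type :: "('a list \<Rightarrow> 'a list) \<Rightarrow> (nat \<Rightarrow> 'a) set \<Rightarrow> (nat \<Rightarrow> 'a) \<Rightarrow> bool" where
  "has_type \<phi> L u \<longleftrightarrow> (\<exists>!d. decomposition \<phi> L u d)"

definition type_of :: "('a list \<Rightarrow> 'a list) \<Rightarrow> (nat \<Rightarrow> 'a) set \<Rightarrow> (nat \<Rightarrow> 'a) \<Rightarrow> 'a \<times> nat" where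
  "type_of \<phi> L u = (let (u', p) = (THE d. decomposition \<phi> L u d) in (u' 0, p))"

definition types :: "('a list \<Rightarrow> 'a list) \<Rightarrow> ('a \<times> nat) set" where
  "types \<phi> = {(a, p). p < length (\<phi> [a])}"

definition type_order ::
    "('a::linorder list \<Rightarrow> 'a list) \<Rightarrow> (nat \<Rightarrow> 'a) set \<Rightarrow> ('a \<times> nat) rel \<Rightarrow> bool" where
  "type_order \<phi> L r \<longleftrightarrow>
    strict_linear_order_on (types \<phi>) r \<and>
    (\<forall>u\<in>L. \<forall>v\<in>L. (type_of \<phi> L u, type_of \<phi> L v) \<in> r \<longrightarrow> less_fun u v)"

definition separable :: "('a::linorder list \<Rightarrow> 'a list) \<Rightarrow> (nat \<Rightarrow> 'a) set \<Rightarrow> bool" where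
  "separable \<phi> L \<longleftrightarrow> (\<forall>u\<in>L. has_type \<phi> L u) \<and> (\<exists>r. type_order \<phi> L r)"

text \<open>
  Points of the extended interval: \<open>Minus x\<close> and \<open>Plus x\<close> are the two copies of a doubled point
  \<open>x\<close>, and \<open>Plain x\<close> is a point that is not doubled.
\<close>

datatype xreal = Minus real | Plain real | Plus real

primrec real_of :: "xreal \<Rightarrow> real" where
  "real_of (Minus x) = x"
| "real_of (Plain x) = x"
| "real_of (Plus x) = x"

primrec sign_of :: "xreal \<Rightarrow> int" where
  "sign_of (Minus x) = - 1"
| "sign_of (Plain x) = 0"
| "sign_of (Plus x) = 1"

instantiation xreal :: linorder
begin

definition less_eq_xreal :: "xreal \<Rightarrow> xreal \<Rightarrow> bool" where
  "s \<le> t \<longleftrightarrow> real_of s < real_of t \<or> real_of s = real_of t \<and> sign_of s \<le> sign_of t"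

definition less_xreal :: "xreal \<Rightarrow> xreal \<Rightarrow> bool" where
  "s < t \<longleftrightarrow> real_of s < real_of t \<or> real_of s = real_of t \<and> sign_of s < sign_of t"

instance
proof
  fix s t :: xreal
  show "s \<le> t \<Longrightarrow> t \<le> s \<Longrightarrow> s = t"
    by (cases s; cases t) (auto simp: less_eq_xreal_def)
qed (auto simp: less_eq_xreal_def less_xreal_def)

end

definition nu_real :: "(nat \<Rightarrow> 'a::linorder) set \<Rightarrow> (nat \<Rightarrow> 'a) measure \<Rightarrow> (nat \<Rightarrow> 'a) \<Rightarrow> real" where
  "nu_real L \<mu> v =
    (let w_min = (THE w. w \<in> L \<and> (\<forall>x\<in>L. lex_le w x))
     in measure \<mu> {x \<in> L. lex_le w_min x \<and> lex_le x v})"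

definition consecutive ::
    "(nat \<Rightarrow> 'a::linorder) set \<Rightarrow> (nat \<Rightarrow> 'a) \<Rightarrow> (nat \<Rightarrow> 'a) \<Rightarrow> bool" where
  "consecutive L u v \<longleftrightarrow>
    u \<in> L \<and> v \<in> L \<and> less_fun u v \<and> \<not> (\<exists>x\<in>L. less_fun u x \<and> less_fun x v)"

definition doubled_points :: "(nat \<Rightarrow> 'a::linorder) set \<Rightarrow> (nat \<Rightarrow> 'a) measure \<Rightarrow> real set" where
  "doubled_points L \<mu> = {nu_real L \<mu> u |u v. consecutive L u v}"

definition ext_interval :: "(nat \<Rightarrow> 'a::linorder) set \<Rightarrow> (nat \<Rightarrow> 'a) measure \<Rightarrow> xreal set" where
  "ext_interval L \<mu> =
    (let Z = doubled_points L \<mu> in Plain ` ({0..1} - Z) \<union> Minus ` Z \<union> Plus ` Z)"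

definition nu :: "(nat \<Rightarrow> 'a::linorder) set \<Rightarrow> (nat \<Rightarrow> 'a) measure \<Rightarrow> (nat \<Rightarrow> 'a) \<Rightarrow> xreal" where
  "nu L \<mu> v =
    (if \<exists>u. consecutive L v u then Minus (nu_real L \<mu> v)
     else if \<exists>u. consecutive L u v then Plus (nu_real L \<mu> v)
     else Plain (nu_real L \<mu> v))"

definition nu_word ::
    "(nat \<Rightarrow> 'a::linorder) set \<Rightarrow> (nat \<Rightarrow> 'a) measure \<Rightarrow> (nat \<Rightarrow> 'a) \<Rightarrow> nat \<Rightarrow> xreal" where
  "nu_word L \<mu> w = (\<lambda>n. nu L \<mu> ((shift ^^ n) w))"

text \<open>The points \<open>x\<^sup>-\<close> and \<open>x\<^sup>+\<close>, both of which are \<open>x\<close> itself unless it is one of the doubled points \<open>Z\<close>.\<close>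

definition left_copy :: "real set \<Rightarrow> real \<Rightarrow> xreal" where
  "left_copy Z x = (if x \<in> Z then Minus x else Plain x)"

definition right_copy :: "real set \<Rightarrow> real \<Rightarrow> xreal" where
  "right_copy Z x = (if x \<in> Z then Plus x else Plain x)"

definition letter_measure :: "(nat \<Rightarrow> 'a) set \<Rightarrow> (nat \<Rightarrow> 'a) measure \<Rightarrow> 'a \<Rightarrow> real" where
  "letter_measure L \<mu> a = measure \<mu> {w \<in> L. w 0 = a}"

definition letter_interval ::
    "(nat \<Rightarrow> 'a::{finite,linorder}) set \<Rightarrow> (nat \<Rightarrow> 'a) measure \<Rightarrow> 'a \<Rightarrow> xreal set" where
  "letter_interval L \<mu> a =
    (let Z = doubled_points L \<mu>
     in {right_copy Z (\<Sum>b\<in>{..<a}. letter_measure L \<mu> b) ..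
         left_copy Z (\<Sum>b\<in>{..a}. letter_measure L \<mu> b)} \<inter> ext_interval L \<mu>)"

definition type_length ::
    "('a::finite list \<Rightarrow> 'a list) \<Rightarrow> (nat \<Rightarrow> 'a) set \<Rightarrow> (nat \<Rightarrow> 'a) measure \<Rightarrow> 'a \<times> nat \<Rightarrow> real" where
  "type_length \<phi> L \<mu> = (\<lambda>(b, p).
    letter_measure L \<mu> b / perron_frobenius (incidence_matrix \<phi>))"

text \<open>
  The increasing affine bijection from the letter interval \<open>I\<^sub>a\<close> to the type interval
  \<open>J\<^bsub>a,p\<^esub>\<close>, with \<open>r\<close> the order on types: \<open>x\<^sub>1, x\<^sub>2\<close> and \<open>y\<^sub>1, y\<^sub>2\<close> are the real
  endpoints of \<open>I\<^sub>a\<close> and \<open>J\<^bsub>a,p\<^esub>\<close>.  The endpoints are treated first since their signs need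
  not agree: the lower endpoint of \<open>I\<^sub>a\<close> may be the undoubled point \<open>0\<close> while that of
  \<open>J\<^bsub>a,p\<^esub>\<close> is of the form \<open>Plus y\<^sub>1\<close>, and vice versa; likewise at \<open>1\<close>.
\<close>

definition branch ::
    "('a::{finite,linorder} list \<Rightarrow> 'a list) \<Rightarrow> (nat \<Rightarrow> 'a) set \<Rightarrow> (nat \<Rightarrow> 'a) measure \<Rightarrow>
      ('a \<times> nat) rel \<Rightarrow> 'a \<Rightarrow> nat \<Rightarrow> xreal \<Rightarrow> xreal" where
  "branch \<phi> L \<mu> r a p s =
    (let Z = doubled_points L \<mu>;
         x\<^sub>1 = (\<Sum>b\<in>{..<a}. letter_measure L \<mu> b);
         x\<^sub>2 = (\<Sum>b\<in>{..a}. letter_measure L \<mu> b);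
         y\<^sub>1 = (\<Sum>t\<in>{t \<in> types \<phi>. (t, (a, p)) \<in> r}. type_length \<phi> L \<mu> t);
         y\<^sub>2 = (\<Sum>t\<in>{t \<in> types \<phi>. (t, (a, p)) \<in> r \<or> t = (a, p)}. type_length \<phi> L \<mu> t);
         g = (\<lambda>x. (y\<^sub>2 - y\<^sub>1) / (x\<^sub>2 - x\<^sub>1) * (x - x\<^sub>1) + y\<^sub>1)
     in if s = right_copy Z x\<^sub>1 then right_copy Z y\<^sub>1
        else if s = left_copy Z x\<^sub>2 then left_copy Z y\<^sub>2
        else (case s of
            Minus x \<Rightarrow> Minus (g x)
          | Plain x \<Rightarrow> Plain (g x)
          | Plus x \<Rightarrow> Plus (g x)))"

definition ext_morphism ::
    "('a::{finite,linorder} list \<Rightarrow> 'a list) \<Rightarrow> (nat \<Rightarrow> 'a) set \<Rightarrow> (nat \<Rightarrow> 'a) measure \<Rightarrow>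
      ('a \<times> nat) rel \<Rightarrow> xreal list \<Rightarrow> xreal list" where
  "ext_morphism \<phi> L \<mu> r ss =
    concat (map (\<lambda>s. let a = (THE a. s \<in> letter_interval L \<mu> a)
                     in map (\<lambda>p. branch \<phi> L \<mu> r a p s) [0..<length (\<phi> [a])]) ss)"

end

theory Submission
  imports Defs
begin

text \<open>
  Every \<open>u \<in> L\<close> is \<open>F p v = \<sigma>\<^sup>p(\<phi>(v))\<close> for exactly one pair \<open>(v, p)\<close>, and \<open>F p\<close> maps the words of
  \<open>L\<close> starting with \<open>a\<close> increasingly onto an order-convex subset of \<open>L\<close>.  Hence the claim reduces
  to \<open>\<mu>(\<phi>(A)) = \<mu>(A) / \<theta>\<close> for initial segments \<open>A\<close> of \<open>L\<close>.

  For a shift-invariant content \<open>m\<close> on \<open>L\<close>, uniqueness of decompositions makes \<open>A \<mapsto> m(\<phi>(A))\<close>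
  shift-invariant again.  The letter vectors \<open>v\<^sub>k\<close> of the iterates of \<open>\<mu>\<close> satisfy
  \<open>v\<^sub>k = M v\<^sub>k\<^sub>+\<^sub>1\<close> with \<open>M\<close> the incidence matrix.  As powers of \<open>M\<close> contract the positive cone, all
  \<open>v\<^sub>k\<close> are proportional, so that \<open>v\<^sub>k = \<kappa>\<^sup>k v\<^sub>0\<close> and \<open>\<kappa> = 1 / \<theta>\<close>.  For initial segments, the defect
  \<open>\<mu>(\<phi>(A)) - \<kappa> \<mu>(A)\<close> is passed on unchanged by desubstitution, while the masses involved tend to
  \<open>0\<close>; so it vanishes.  The same decay shows that \<open>\<mu>\<close> has no atoms.  As every cylinder meeting \<open>L\<close>
  has positive measure, \<open>L\<close> then has no isolated points, and \<open>\<nu>\<close> is strictly increasing.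
\<close>

section \<open>Infinite words\<close>

text \<open>Since v_0 = M^k v_k and v_1 = M^k v_(k+1) for every k, with all these vectors
  nonnegative, v_0 and v_1 lie in each cone M^k C, where C is the nonnegative cone. By primitivity
  these cones shrink to a single ray. This is where \<kappa> comes from, and positivity of v_0 makes
  it a Perron-Frobenius eigenvector.

  The mass identity only settles the real parts of the values of \<nu>. The sign of \<nu>(v) records
  whether v has an immediate neighbour in L, above or below. As the image of a letter cylinder under
  \<open>F p\<close> is order-convex, neighbours inside the cylinder become neighbours of the images
  and conversely. Only the least and the greatest word of the cylinder escape this: their
  neighbours, if any, start with another letter, and those of their images have another type. These
  are the endpoints that \<open>branch\<close> treats separately.

  Order-convexity also settles the measurability of \<phi>(A): convex subsets of L are Borel, and
  convex subsets of a letter cylinder have convex images under \<open>F p\<close>.\<close>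

lemma shift_funpow: "(shift ^^ n) w = (\<lambda>i. w (n + i))"
  by (induction n arbitrary: w) (auto simp: shift_def fun_eq_iff)

lemma less_fun_total: "less_fun u v \<or> u = v \<or> less_fun v u"
  for u v :: "nat \<Rightarrow> 'b::linorder"
proof (cases "u = v")
  case False
  define k where "k = (LEAST k. u k \<noteq> v k)"
  have "\<exists>k. u k \<noteq> v k"
    using False by auto
  then have "u k \<noteq> v k"
    unfolding k_def by (rule LeastI_ex)
  moreover have "\<And>i. i < k \<Longrightarrow> u i = v i"
    using not_less_Least unfolding k_def by blast
  ultimately have "less_fun u v \<or> less_fun v u"
    unfolding less_fun_def by (metis neqE)
  then show ?thesis by blast
qed simp

text \<open>The comparison is decided at the first difference, so it survives any change of
  \<open>u\<close> beyond it: the strict order is open in the product topology.\<close>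

lemma less_fun_open_left:
  fixes u v :: "nat \<Rightarrow> 'b::linorder"
  assumes "less_fun u v"
  obtains n where "\<forall>y. (\<forall>i<n. y i = u i) \<longrightarrow> less_fun y v"
proof -
  obtain k where k: "u k < v k" "\<And>i. i < k \<Longrightarrow> u i = v i"
    using assms by (blast elim!: less_funE)
  then have "less_fun y v" if "\<forall>i<Suc k. y i = u i" for y
    using that unfolding less_fun_def by (intro exI[of _ k]) auto
  then show ?thesis using that by blast
qed

lemma less_fun_open_right:
  fixes u v :: "nat \<Rightarrow> 'b::linorder"
  assumes "less_fun u v"
  obtains n where "\<forall>y. (\<forall>i<n. y i = v i) \<longrightarrow> less_fun u y"
proof -
  obtain k where k: "u k < v k" "\<And>i. i < k \<Longrightarrow> u i = v i"
    using assms by (blast elim!: less_funE)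
  then have "less_fun u y" if "\<forall>i<Suc k. y i = v i" for y
    using that unfolding less_fun_def by (intro exI[of _ k]) auto
  then show ?thesis using that by blast
qed

lemma less_lex_le_trans: "less_fun u v \<Longrightarrow> lex_le v w \<Longrightarrow> less_fun u w"
  by (auto simp: lex_le_def intro: less_fun_trans)

lemma not_lex_le: "\<not> lex_le u v \<longleftrightarrow> less_fun v u" for u v :: "nat \<Rightarrow> 'b::linorder"
  using less_fun_total[of u v] less_fun_asym less_fun_irrefl unfolding lex_le_def by blast

lemma not_less_fun: "\<not> less_fun u v \<longleftrightarrow> lex_le v u" for u v :: "nat \<Rightarrow> 'b::linorder"
  using not_lex_le by blast

lemma lex_le_refl [simp]: "lex_le u u"
  by (simp add: lex_le_def)

lemma lex_le_antisym: "lex_le u v \<Longrightarrow> lex_le v u \<Longrightarrow> u = v"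
  using less_fun_asym unfolding lex_le_def by blast

lemma less_imp_lex_le: "less_fun u v \<Longrightarrow> lex_le u v"
  by (simp add: lex_le_def)

lemma lex_le_first: "lex_le u v \<Longrightarrow> u 0 \<le> v 0"
  unfolding lex_le_def less_fun_def by (metis less_imp_le order_refl zero_less_iff_neq_zero)

lemma first_less_imp_less: "u 0 < v 0 \<Longrightarrow> less_fun u v" for u v :: "nat \<Rightarrow> 'b::linorder"
  unfolding less_fun_def by (rule exI[of _ 0]) auto

text \<open>Letters are chosen one at a time, each by \<open>sel\<close> among the continuations
  that still occur in \<open>K\<close>. Every prefix is then realised in \<open>K\<close>, and
  closedness in the product topology puts the limit into \<open>K\<close>. With \<open>Min\<close>
  and \<open>Max\<close> for \<open>sel\<close> this yields extreme elements.\<close>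

lemma closed_has_greedy_element:
  fixes K :: "(nat \<Rightarrow> 'b) set"
  assumes "K \<noteq> {}" and closed: "\<And>w. (\<And>n. \<exists>y\<in>K. \<forall>i<n. y i = w i) \<Longrightarrow> w \<in> K"
    and sel: "\<And>A. A \<noteq> {} \<Longrightarrow> sel A \<in> A"
  obtains w where "w \<in> K" and "\<And>n. w n = sel {y n |y. y \<in> K \<and> (\<forall>i<n. y i = w i)}"
proof -
  \<comment> \<open>\<open>g n\<close> is the prefix of length n; the recursion runs over prefixes
    because the next choice depends on all earlier letters.\<close>
  define g where
    "g = rec_nat [] (\<lambda>n l. l @ [sel {y n |y. y \<in> K \<and> map y [0..<n] = l}])"
  have g0: "g 0 = []"
    and gS: "g (Suc n) = g n @ [sel {y n |y. y \<in> K \<and> map y [0..<n] = g n}]" for n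
    by (simp_all add: g_def)
  define w where "w n = sel {y n |y. y \<in> K \<and> map y [0..<n] = g n}" for n
  have g: "map w [0..<n] = g n" for n
    by (induction n) (simp_all add: g0 gS w_def)
  have agree: "map y [0..<n] = map w [0..<n] \<longleftrightarrow> (\<forall>i<n. y i = w i)" for y n
    by (auto simp: list_eq_iff_nth_eq)
  have w: "w n = sel {y n |y. y \<in> K \<and> (\<forall>i<n. y i = w i)}" for n
    using w_def[of n] unfolding g[symmetric] agree .
  have "\<exists>y\<in>K. \<forall>i<n. y i = w i" for n
  proof (induction n)
    case 0
    then show ?case using \<open>K \<noteq> {}\<close> by auto
  next
    case (Suc n)
    then have "{y n |y. y \<in> K \<and> (\<forall>i<n. y i = w i)} \<noteq> {}" by blast
    from sel[OF this] have "w n \<in> {y n |y. y \<in> K \<and> (\<forall>i<n. y i = w i)}"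
      using w[of n] by simp
    then show ?case by (auto simp: less_Suc_eq)
  qed
  then have "w \<in> K" by (rule closed)
  with w show ?thesis using that by blast
qed

lemma closed_has_least:
  fixes K :: "(nat \<Rightarrow> 'b::{finite,linorder}) set"
  assumes "K \<noteq> {}" and "\<And>w. (\<And>n. \<exists>y\<in>K. \<forall>i<n. y i = w i) \<Longrightarrow> w \<in> K"
  obtains w where "w \<in> K" and "\<And>y. y \<in> K \<Longrightarrow> lex_le w y"
proof -
  obtain w where w: "w \<in> K" "\<And>n. w n = Min {y n |y. y \<in> K \<and> (\<forall>i<n. y i = w i)}"
  proof (rule closed_has_greedy_element[where sel = Min])
    show "K \<noteq> {}" by fact
    show "w \<in> K" if "\<And>n. \<exists>y\<in>K. \<forall>i<n. y i = w i" for w using that by (rule assms(2))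
    show "Min A \<in> A" if "A \<noteq> {}" for A :: "'b set" using that by (intro Min_in) auto
  qed (rule that)
  have "lex_le w y" if "y \<in> K" for y
  proof (rule ccontr)
    assume "\<not> lex_le w y"
    then obtain k where k: "y k < w k" "\<And>i. i < k \<Longrightarrow> y i = w i"
      by (auto simp: not_lex_le elim: less_funE)
    have "w k \<le> y k"
      unfolding w(2)[of k] using k that by (intro Min_le) auto
    with k show False by simp
  qed
  with w that show ?thesis by blast
qed

lemma closed_has_greatest:
  fixes K :: "(nat \<Rightarrow> 'b::{finite,linorder}) set"
  assumes "K \<noteq> {}" and "\<And>w. (\<And>n. \<exists>y\<in>K. \<forall>i<n. y i = w i) \<Longrightarrow> w \<in> K"
  obtains w where "w \<in> K" and "\<And>y. y \<in> K \<Longrightarrow> lex_le y w"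
proof -
  obtain w where w: "w \<in> K" "\<And>n. w n = Max {y n |y. y \<in> K \<and> (\<forall>i<n. y i = w i)}"
  proof (rule closed_has_greedy_element[where sel = Max])
    show "K \<noteq> {}" by fact
    show "w \<in> K" if "\<And>n. \<exists>y\<in>K. \<forall>i<n. y i = w i" for w using that by (rule assms(2))
    show "Max A \<in> A" if "A \<noteq> {}" for A :: "'b set" using that by (intro Max_in) auto
  qed (rule that)
  have "lex_le y w" if "y \<in> K" for y
  proof (rule ccontr)
    assume "\<not> lex_le y w"
    then obtain k where k: "w k < y k" "\<And>i. i < k \<Longrightarrow> w i = y i"
      by (auto simp: not_lex_le elim: less_funE)
    have "y k \<le> w k"
      unfolding w(2)[of k] using k that by (intro Max_ge) auto
    with k show False by simp
  qed
  with w that show ?thesis by blast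
qed

text \<open>A basic open set of the product constrains only finitely many coordinates, so cylinders
  form a neighbourhood base, and closure means that every prefix of \<open>u\<close> is a factor of
  \<open>x\<close>.\<close>

lemma orbit_closure_iff: "u \<in> orbit_closure x \<longleftrightarrow> (\<forall>n. \<exists>m. \<forall>i<n. u i = x (m + i))"
proof
  assume u: "u \<in> orbit_closure x"
  show "\<forall>n. \<exists>m. \<forall>i<n. u i = x (m + i)"
  proof
    fix n
    let ?T = "\<Pi>\<^sub>E i\<in>UNIV. if i < n then {u i} else UNIV"
    have "{i. (if i < n then {u i} else UNIV) \<noteq> UNIV} \<subseteq> {..<n}" by auto
    then have "finite {i. (if i < n then {u i} else UNIV) \<noteq> UNIV}"
      by (rule finite_subset) simp
    then have "openin (product_topology (\<lambda>_. discrete_topology UNIV) UNIV) ?T"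
      by (subst openin_PiE_gen) auto
    moreover have "u \<in> ?T" by (auto simp: PiE_def)
    ultimately obtain y where "y \<in> {(shift ^^ m) x |m. True}" "y \<in> ?T"
      using u unfolding orbit_closure_def in_closure_of by blast
    then obtain m where y: "y = (\<lambda>i. x (m + i))" "y \<in> ?T"
      by (auto simp: shift_funpow)
    have "u i = x (m + i)" if "i < n" for i
    proof -
      have "y i \<in> (if i < n then {u i} else UNIV)" using y(2) by (rule PiE_mem) simp
      then show ?thesis using that y(1) by auto
    qed
    then show "\<exists>m. \<forall>i<n. u i = x (m + i)" by blast
  qed
next
  assume u: "\<forall>n. \<exists>m. \<forall>i<n. u i = x (m + i)"
  have "\<exists>y. y \<in> {(shift ^^ m) x |m. True} \<and> y \<in> T"
    if T: "u \<in> T" "openin (product_topology (\<lambda>_. discrete_topology UNIV) UNIV) T" for T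
  proof -
    obtain U where "finite {i \<in> UNIV. U i \<noteq> topspace (discrete_topology (UNIV :: 'a set))}"
      and U: "u \<in> Pi\<^sub>E UNIV U" "Pi\<^sub>E UNIV U \<subseteq> T"
      using bspec[OF T(2)[unfolded openin_product_topology_alt] T(1)] by blast
    then have fin: "finite {i. U i \<noteq> UNIV}" by simp
    obtain n where n: "\<And>i. U i \<noteq> UNIV \<Longrightarrow> i < n"
      using finite_nat_bounded[OF fin] by (auto simp: subset_iff)
    obtain m where m: "\<forall>i<n. u i = x (m + i)" using u by blast
    have "x (m + i) \<in> U i" for i
      using n[of i] m U(1) by (cases "U i = UNIV") (auto simp: PiE_def Pi_def dest: spec[of _ i])
    then have "(\<lambda>i. x (m + i)) \<in> Pi\<^sub>E UNIV U" by auto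
    with U(2) show ?thesis by (auto simp: shift_funpow)
  qed
  then show "u \<in> orbit_closure x"
    unfolding orbit_closure_def in_closure_of by simp
qed

section \<open>Morphisms\<close>

lemma morphism_append: "morphism h \<Longrightarrow> h (u @ v) = h u @ h v"
  by (simp add: morphism_def)

lemma morphism_Nil: "morphism h \<Longrightarrow> h [] = []"
  by (metis append_Nil append_self_conv2 morphism_append)

lemma morphism_prefix_Suc:
  "morphism h \<Longrightarrow> h (map w [0..<Suc m]) = h (map w [0..<m]) @ h [w m]"
  by (simp add: morphism_append)

lemma morphism_prefix_add:
  "morphism h \<Longrightarrow>
    h (map w [0..<m + n]) = h (map w [0..<m]) @ h (map (\<lambda>i. w (m + i)) [0..<n])"
  by (induction n) (simp_all add: morphism_Nil morphism_append)

text \<open>The image of a longer prefix extends that of a shorter one, so any prefix with a long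
  enough image can replace the least one of the definition.\<close>

lemma inf_image_nth:
  assumes h: "morphism h" and n: "n < length (h (map w [0..<m]))"
  shows "inf_image h w n = h (map w [0..<m]) ! n"
proof -
  define k where "k = (LEAST m. n < length (h (map w [0..<m])))"
  have k: "n < length (h (map w [0..<k]))" "k \<le> m"
    unfolding k_def using n by (auto intro: LeastI Least_le)
  obtain d where "m = k + d" using k(2) le_Suc_ex by blast
  then show ?thesis
    using k(1) by (simp add: inf_image_def k_def[symmetric] morphism_prefix_add[OF h] nth_append)
qed

lemma count_list_morphism:
  fixes h :: "'b::finite list \<Rightarrow> 'c list"
  assumes "morphism h"
  shows "count_list (h l) a = (\<Sum>c\<in>UNIV. count_list l c * count_list (h [c]) a)"
proof (induction l)
  case (Cons d l)
  have "count_list (h (d # l)) a = count_list (h [d]) a + count_list (h l) a"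
    using morphism_append[OF assms, of "[d]" l] by simp
  also have "count_list (h [d]) a = (\<Sum>c\<in>UNIV. (if d = c then 1 else 0) * count_list (h [c]) a)"
    by (simp add: if_distrib[of "\<lambda>x. x * _"] cong: if_cong)
  also have "\<dots> + count_list (h l) a = (\<Sum>c\<in>UNIV. count_list (d # l) c * count_list (h [c]) a)"
    unfolding Cons sum.distrib[symmetric] by (intro sum.cong) auto
  finally show ?case .
qed (simp add: morphism_Nil[OF assms])

lemma morphism_funpow: "morphism h \<Longrightarrow> morphism (h ^^ n)" for h :: "'b list \<Rightarrow> 'b list"
  by (induction n) (auto simp: morphism_def)

section \<open>Contraction of the positive cone\<close>

text \<open>
  The ratios of the entries of \<open>V 0\<close> and \<open>W 0\<close> are averages of those of \<open>V 1\<close> and \<open>W 1\<close>, in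
  which each of the latter has weight at least \<open>\<alpha> / \<beta>\<close>; so the interval containing the ratios
  shrinks by the factor \<open>1 - \<alpha> / \<beta>\<close> with each application of \<open>P\<close>.
\<close>

lemma ratio_contraction:
  fixes P :: "'b::finite \<Rightarrow> 'b \<Rightarrow> real"
  assumes P: "\<And>a b. \<alpha> \<le> P a b" "\<And>a b. P a b \<le> \<beta>" and "0 < \<alpha>"
    and V: "\<And>a. V0 a = (\<Sum>b\<in>UNIV. P a b * V1 b)"
    and W: "\<And>a. W0 a = (\<Sum>b\<in>UNIV. P a b * W1 b)"
    and W1: "\<And>a. 0 \<le> W1 a" "0 < sum W1 UNIV"
    and bounds: "\<And>a. lo * W1 a \<le> V1 a" "\<And>a. V1 a \<le> hi * W1 a"
  obtains lo' hi' where "\<And>a. lo' * W0 a \<le> V0 a" "\<And>a. V0 a \<le> hi' * W0 a"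
    "hi' - lo' = (1 - \<alpha> / \<beta>) * (hi - lo)"
proof -
  have "0 < \<beta>" using P \<open>0 < \<alpha>\<close> by (meson less_le_trans)
  define s X Y where "s = sum W1 UNIV" and "X = (\<Sum>b\<in>UNIV. V1 b - lo * W1 b)"
    and "Y = (\<Sum>b\<in>UNIV. hi * W1 b - V1 b)"
  have "0 < s" using W1 by (simp add: s_def)
  have "0 \<le> X" "0 \<le> Y"
    using bounds unfolding X_def Y_def by (auto intro!: sum_nonneg)
  moreover have "X + Y = (hi - lo) * s"
    unfolding X_def Y_def s_def
    by (simp add: sum_subtractf left_diff_distrib flip: sum_distrib_left)
  ultimately have XY: "0 \<le> X" "0 \<le> Y" "X + Y = (hi - lo) * s" by auto
  have Ws: "W0 a \<le> \<beta> * s" for a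
    unfolding W s_def sum_distrib_left using P W1 by (intro sum_mono mult_right_mono)
  have X: "\<alpha> * X \<le> V0 a - lo * W0 a" for a
  proof -
    have "\<alpha> * X \<le> (\<Sum>b\<in>UNIV. P a b * (V1 b - lo * W1 b))"
      unfolding X_def sum_distrib_left using P bounds by (intro sum_mono mult_right_mono) auto
    also have "\<dots> = V0 a - lo * W0 a"
      unfolding V W sum_distrib_left sum_subtractf[symmetric]
      by (intro sum.cong) (auto simp: algebra_simps)
    finally show ?thesis .
  qed
  have Y: "\<alpha> * Y \<le> hi * W0 a - V0 a" for a
  proof -
    have "\<alpha> * Y \<le> (\<Sum>b\<in>UNIV. P a b * (hi * W1 b - V1 b))"
      unfolding Y_def sum_distrib_left using P bounds by (intro sum_mono mult_right_mono) auto
    also have "\<dots> = hi * W0 a - V0 a"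
      unfolding V W sum_distrib_left sum_subtractf[symmetric]
      by (intro sum.cong) (auto simp: algebra_simps)
    finally show ?thesis .
  qed
  \<comment> \<open>Since \<open>W0 a\<close> is at most \<beta> s, an excess of \<alpha> X over
    \<open>lo * W0 a\<close> allows raising the lower bound by \<alpha> X / (\<beta> s), uniformly
    in \<open>a\<close>; likewise for Y and the upper bound.\<close>
  define \<delta> where "\<delta> = \<alpha> / (\<beta> * s)"
  have \<delta>: "0 \<le> \<delta>" "\<delta> * (\<beta> * s) = \<alpha>"
    using \<open>0 < \<alpha>\<close> \<open>0 < \<beta>\<close> \<open>0 < s\<close> by (auto simp: \<delta>_def)
  have le: "\<delta> * T * W0 a \<le> \<alpha> * T" if "0 \<le> T" for T a
  proof -
    have "\<delta> * T * W0 a \<le> \<delta> * T * (\<beta> * s)"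
      using Ws \<delta>(1) that by (intro mult_left_mono) auto
    also have "\<dots> = \<alpha> * T" using \<delta>(2) by (simp add: algebra_simps)
    finally show ?thesis .
  qed
  show ?thesis
  proof
    show "(lo + \<delta> * X) * W0 a \<le> V0 a" for a
      using le[OF XY(1), of a] X[of a] by (simp add: algebra_simps)
    show "V0 a \<le> (hi - \<delta> * Y) * W0 a" for a
      using le[OF XY(2), of a] Y[of a] by (simp add: algebra_simps)
    have "\<delta> * X + \<delta> * Y = \<delta> * s * (hi - lo)"
      using XY(3) unfolding distrib_left[symmetric] by simp
    also have "\<delta> * s = \<alpha> / \<beta>" using \<open>0 < s\<close> by (simp add: \<delta>_def)
    finally show "(hi - \<delta> * Y) - (lo + \<delta> * X) = (1 - \<alpha> / \<beta>) * (hi - lo)"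
      by (simp add: algebra_simps)
  qed
qed

text \<open>At index k the ratios lie in an interval with \<open>hi\<close> = (\<beta>/\<alpha>)^2
  \<open>lo\<close>, for every k, because vectors in the image of \<open>P\<close> have entries
  comparable up to \<beta>/\<alpha>. Pulling the interval back to index 0 shrinks its width by
  \<rho>^k.\<close>

lemma positive_matrix_orbits_proportional:
  fixes P :: "'b::finite \<Rightarrow> 'b \<Rightarrow> real"
  assumes P: "\<And>a b. 0 < P a b"
    and V: "\<And>k a. V k a = (\<Sum>b\<in>UNIV. P a b * V (Suc k) b)"
    and W: "\<And>k a. W k a = (\<Sum>b\<in>UNIV. P a b * W (Suc k) b)"
    and V0: "\<And>k a. (0::real) \<le> V k a" and W0: "\<And>k a. (0::real) \<le> W k a"
    and Vs: "\<And>k. 0 < sum (V k) UNIV" and Ws: "\<And>k. 0 < sum (W k) UNIV"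
  shows "\<exists>\<kappa>. \<forall>a. V 0 a = \<kappa> * W 0 a"
proof -
  define \<alpha> where "\<alpha> = Min (range (\<lambda>(a, b). P a b))"
  define \<beta> where "\<beta> = Max (range (\<lambda>(a, b). P a b))"
  have P\<alpha>: "\<alpha> \<le> P a b" and P\<beta>: "P a b \<le> \<beta>" for a b
    unfolding \<alpha>_def \<beta>_def by (auto intro!: Min_le Max_ge rev_image_eqI[of "(a, b)"])
  have \<alpha>: "0 < \<alpha>"
    unfolding \<alpha>_def using P by (subst Min_gr_iff) auto
  have "0 < \<beta>" using P P\<beta> by (meson less_le_trans)
  have "\<alpha> \<le> \<beta>" using P\<alpha> P\<beta> order_trans by blast
  define \<rho> where "\<rho> = 1 - \<alpha> / \<beta>"
  have \<rho>: "0 \<le> \<rho>" "\<rho> < 1"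
    using \<alpha> \<open>0 < \<beta>\<close> \<open>\<alpha> \<le> \<beta>\<close> by (auto simp: \<rho>_def)
  have pull: "\<exists>lo' hi'. (\<forall>a. lo' * W 0 a \<le> V 0 a) \<and> (\<forall>a. V 0 a \<le> hi' * W 0 a) \<and>
      hi' - lo' = \<rho> ^ k * (hi - lo)"
    if "\<And>a. lo * W k a \<le> V k a" "\<And>a. V k a \<le> hi * W k a" for k lo hi
    using that
  proof (induction k arbitrary: lo hi)
    case 0
    then show ?case by auto
  next
    case (Suc k)
    obtain lo' hi' where *: "\<And>a. lo' * W k a \<le> V k a" "\<And>a. V k a \<le> hi' * W k a"
      "hi' - lo' = (1 - \<alpha> / \<beta>) * (hi - lo)"
      by (rule ratio_contraction[OF P\<alpha> P\<beta> \<alpha> V W W0 Ws Suc.prems]) (rule that)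
    show ?case using Suc.IH[OF *(1,2)] unfolding *(3) \<rho>_def[symmetric] by (simp add: mult.assoc mult.left_commute)
  qed
  have lower: "\<alpha> * sum (U (Suc k)) UNIV \<le> U k a"
    and upper: "U k a \<le> \<beta> * sum (U (Suc k)) UNIV"
    if U: "\<And>k a. U k a = (\<Sum>b\<in>UNIV. P a b * U (Suc k) b)" "\<And>k a. 0 \<le> U k a"
    for U :: "nat \<Rightarrow> 'b \<Rightarrow> real" and k a
    unfolding U(1)[of k] sum_distrib_left using U(2) P\<alpha> P\<beta>
    by (auto intro!: sum_mono mult_right_mono)
  have W_pos: "0 < W k a" for k a
    using lower[of W, OF W W0, of k a] Ws[of "Suc k"] \<alpha> by (meson less_le_trans mult_pos_pos)
  fix a\<^sub>0 :: 'b
  \<comment> \<open>The letter \<open>a\<^sub>0\<close> is an arbitrary reference: the ratio there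
    is compared with the ratio at every other letter.\<close>
  define \<kappa> where "\<kappa> = V 0 a\<^sub>0 / W 0 a\<^sub>0"
  have "\<kappa> \<ge> 0" using V0 W0 by (simp add: \<kappa>_def)
  have bound: "\<bar>V 0 a - \<kappa> * W 0 a\<bar> \<le> \<rho> ^ k * ((\<beta> / \<alpha>)\<^sup>2 * \<kappa> * W 0 a)" for k a
  proof -
    define sV sW where "sV = sum (V (Suc k)) UNIV" and "sW = sum (W (Suc k)) UNIV"
    have s: "0 < sV" "0 < sW" using Vs Ws by (auto simp: sV_def sW_def)
    define lo hi where "lo = \<alpha> * sV / (\<beta> * sW)" and "hi = \<beta> * sV / (\<alpha> * sW)"
    have hi: "hi = (\<beta> / \<alpha>)\<^sup>2 * lo"
      using \<alpha> \<open>0 < \<beta>\<close> s by (simp add: lo_def hi_def power2_eq_square field_simps)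
    have "0 < lo" using \<alpha> \<open>0 < \<beta>\<close> s by (simp add: lo_def)
    have "0 < hi" using \<alpha> \<open>0 < \<beta>\<close> s by (simp add: hi_def)
    have lo_le: "lo * W k a \<le> V k a" for a
    proof -
      have "lo * W k a \<le> lo * (\<beta> * sW)"
        using upper[of W, OF W W0, of k a] \<open>0 < lo\<close> by (intro mult_left_mono) (auto simp: sW_def)
      also have "\<dots> = \<alpha> * sV" using \<open>0 < \<beta>\<close> s by (simp add: lo_def)
      also have "\<dots> \<le> V k a" using lower[of V, OF V V0] by (simp add: sV_def)
      finally show ?thesis .
    qed
    have hi_ge: "V k a \<le> hi * W k a" for a
    proof -
      have "V k a \<le> \<beta> * sV" using upper[of V, OF V V0] by (simp add: sV_def)
      also have "\<dots> = hi * (\<alpha> * sW)" using \<alpha> s by (simp add: hi_def)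
      also have "\<dots> \<le> hi * W k a"
        using lower[of W, OF W W0, of k a] \<open>0 < hi\<close> by (intro mult_left_mono) (auto simp: sW_def)
      finally show ?thesis .
    qed
    \<comment> \<open>The starting width must be bounded independently of k. Lower bounds survive
      each application of \<open>P\<close>, so \<open>lo\<close> is at most the ratio \<kappa> at
      index 0, and \<open>hi\<close> is a fixed multiple of \<open>lo\<close>.\<close>
    have lo_\<kappa>: "lo \<le> \<kappa>"
    proof -
      have "lo * W j a \<le> V j a" if "j \<le> k" for j a
        using that
      proof (induction "k - j" arbitrary: j a)
        case 0
        then show ?case using lo_le by simp
      next
        case (Suc d)
        then have IH: "lo * W (Suc j) b \<le> V (Suc j) b" for b by simp
        have "lo * W j a = (\<Sum>b\<in>UNIV. P a b * (lo * W (Suc j) b))"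
          unfolding W[of j a] sum_distrib_left by (intro sum.cong) (auto simp: algebra_simps)
        also have "\<dots> \<le> V j a"
          unfolding V[of j a] using IH P by (intro sum_mono mult_left_mono) (auto intro: less_imp_le)
        finally show ?case .
      qed
      from this[of 0 a\<^sub>0] show ?thesis using W_pos[of 0 a\<^sub>0] by (simp add: \<kappa>_def field_simps)
    qed
    obtain lo' hi' where *: "\<And>a. lo' * W 0 a \<le> V 0 a" "\<And>a. V 0 a \<le> hi' * W 0 a"
      "hi' - lo' = \<rho> ^ k * (hi - lo)"
      using pull[OF lo_le hi_ge] by blast
    have "lo' \<le> \<kappa>" "\<kappa> \<le> hi'"
      using *(1,2)[of a\<^sub>0] W_pos[of 0 a\<^sub>0] by (auto simp: \<kappa>_def field_simps)
    then have "lo' * W 0 a \<le> \<kappa> * W 0 a" "\<kappa> * W 0 a \<le> hi' * W 0 a"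
      using W0 by (auto intro: mult_right_mono)
    then have "\<bar>V 0 a - \<kappa> * W 0 a\<bar> \<le> (hi' - lo') * W 0 a"
      using *(1,2)[of a] by (auto simp: algebra_simps)
    also have "\<dots> \<le> \<rho> ^ k * hi * W 0 a"
      unfolding *(3) using \<rho> \<open>0 < lo\<close> W0 by (intro mult_right_mono mult_left_mono) auto
    also have "\<dots> \<le> \<rho> ^ k * ((\<beta> / \<alpha>)\<^sup>2 * \<kappa>) * W 0 a"
      unfolding hi using \<rho> lo_\<kappa> W0 by (intro mult_right_mono mult_left_mono) auto
    finally show ?thesis by (simp add: mult.assoc)
  qed
  have "V 0 a = \<kappa> * W 0 a" for a
  proof -
    have "(\<lambda>k. \<rho> ^ k * ((\<beta> / \<alpha>)\<^sup>2 * \<kappa> * W 0 a)) \<longlonglongrightarrow> 0 * ((\<beta> / \<alpha>)\<^sup>2 * \<kappa> * W 0 a)"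
      using \<rho> by (intro tendsto_mult_right LIMSEQ_realpow_zero)
    then have "\<bar>V 0 a - \<kappa> * W 0 a\<bar> \<le> 0"
      by (intro LIMSEQ_le_const[where X = "\<lambda>k. \<rho> ^ k * ((\<beta> / \<alpha>)\<^sup>2 * \<kappa> * W 0 a)"])
        (use bound in auto)
    then show ?thesis by simp
  qed
  then show ?thesis by blast
qed

text \<open>
  Compare any complex eigenvector with the positive one at the letter where the ratio of moduli
  is largest.
\<close>

lemma perron_frobenius_eqI:
  fixes A :: "complex ^ 'n::finite ^ 'n" and v :: "'n \<Rightarrow> real"
  assumes A: "\<And>i j. A $ i $ j = complex_of_real (M i j)" and M: "\<And>i j. 0 \<le> M i j"
    and v: "\<And>i. 0 < v i" and ev: "\<And>i. (\<Sum>j\<in>UNIV. M i j * v j) = \<theta> * v i"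
  shows "perron_frobenius A = \<theta>"
proof -
  have "eigenvalue A (complex_of_real \<theta>)"
    unfolding eigenvalue_def
  proof (intro exI conjI)
    show "(\<chi> i. complex_of_real (v i)) \<noteq> 0"
      using v by (auto simp: vec_eq_iff less_le)
    show "A *v (\<chi> i. complex_of_real (v i)) = complex_of_real \<theta> *s (\<chi> i. complex_of_real (v i))"
      by (auto simp: vec_eq_iff matrix_vector_mult_def A simp flip: of_real_mult of_real_sum ev)
  qed
  moreover have "cmod z \<le> \<theta>" if z: "eigenvalue A z" for z
  proof -
    obtain w where w: "w \<noteq> 0" "A *v w = z *s w"
      using z unfolding eigenvalue_def by blast
    obtain k where k: "\<And>i. cmod (w $ i) / v i \<le> cmod (w $ k) / v k"
    proof -
      have "Max (range (\<lambda>i. cmod (w $ i) / v i)) \<in> range (\<lambda>i. cmod (w $ i) / v i)"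
        by (intro Max_in) auto
      then have "\<exists>k. Max (range (\<lambda>i. cmod (w $ i) / v i)) = cmod (w $ k) / v k" by blast
      then obtain k where k: "Max (range (\<lambda>i. cmod (w $ i) / v i)) = cmod (w $ k) / v k" ..
      show ?thesis by (rule that[of k]) (simp flip: k)
    qed
    define t where "t = cmod (w $ k) / v k"
    have wv: "cmod (w $ i) \<le> t * v i" for i
      using k[of i] v[of i] by (simp add: t_def pos_divide_le_eq)
    obtain i where "w $ i \<noteq> 0" using w by (auto simp: vec_eq_iff)
    then have "0 < t * v i" using wv[of i] by (metis less_le_trans zero_less_norm_iff)
    then have "0 < t" using v[of i] zero_less_mult_pos2 by blast
    have tk: "t * v k = cmod (w $ k)" using v[of k] by (simp add: t_def)
    have "cmod z * cmod (w $ k) = cmod ((A *v w) $ k)"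
      by (simp add: w(2) norm_mult)
    also have "\<dots> \<le> (\<Sum>j\<in>UNIV. cmod (A $ k $ j * w $ j))"
      unfolding matrix_vector_mult_def by (simp add: norm_sum)
    also have "\<dots> \<le> (\<Sum>j\<in>UNIV. M k j * (t * v j))"
      using M wv by (intro sum_mono) (auto simp: norm_mult A intro!: mult_left_mono)
    also have "\<dots> = t * (\<theta> * v k)"
      unfolding ev[symmetric] sum_distrib_left by (intro sum.cong) (auto simp: algebra_simps)
    also have "\<dots> = \<theta> * cmod (w $ k)" using tk by (simp add: algebra_simps)
    finally show ?thesis
      using \<open>0 < t\<close> v[of k] tk by (metis mult_le_cancel_right_pos mult_pos_pos)
  qed
  ultimately show ?thesis
    unfolding perron_frobenius_def
  proof (intro the_equality conjI allI impI)
    fix s assume "eigenvalue A (complex_of_real s) \<and> (\<forall>z. eigenvalue A z \<longrightarrow> cmod z \<le> s)"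
    moreover have "0 \<le> \<theta>"
    proof -
      fix i
      have "0 \<le> \<theta> * v i" unfolding ev[symmetric] using M less_imp_le[OF v] by (simp add: sum_nonneg)
      then show ?thesis using v[of i] by (simp add: zero_le_mult_iff)
    qed
    ultimately show "s = \<theta>"
      using \<open>eigenvalue A (complex_of_real \<theta>)\<close> \<open>\<And>z. eigenvalue A z \<Longrightarrow> cmod z \<le> \<theta>\<close>
      by (metis abs_le_iff abs_of_nonneg norm_of_real order_antisym)
  qed auto
qed

section \<open>Desubstitution\<close>

locale separable_substitution =
  fixes \<phi> :: "'a::{finite,linorder} list \<Rightarrow> 'a list" and x :: "nat \<Rightarrow> 'a"
    and L :: "(nat \<Rightarrow> 'a) set" and r :: "('a \<times> nat) rel"
  assumes primitive: "primitive_morphism \<phi>" and fixed_point: "inf_image \<phi> x = x"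
    and aperiodic: "aperiodic x" and L_eq: "L = orbit_closure x"
    and separable: "separable \<phi> L" and type_order: "type_order \<phi> L r"
    and order_preserving: "order_preserving_on L \<phi>"
begin

abbreviation \<Phi> :: "(nat \<Rightarrow> 'a) \<Rightarrow> nat \<Rightarrow> 'a" where "\<Phi> \<equiv> inf_image \<phi>"

definition F :: "nat \<Rightarrow> (nat \<Rightarrow> 'a) \<Rightarrow> nat \<Rightarrow> 'a" where "F p u = (shift ^^ p) (\<Phi> u)"

definition cyl :: "'a \<Rightarrow> (nat \<Rightarrow> 'a) set" where "cyl a = {w \<in> L. w 0 = a}"

lemma cylD: "u \<in> cyl a \<Longrightarrow> u \<in> L" "u \<in> cyl a \<Longrightarrow> u 0 = a"
  by (auto simp: cyl_def)

lemma hom: "morphism \<phi>"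
  using primitive by (simp add: primitive_morphism_def)

text \<open>This excludes a degenerate case: over one letter the exponent 0 would already witness
  primitivity, and neither nonerasing nor growth would follow. Over one letter \<open>x\<close>
  would be constant.\<close>

lemma two_letters: "\<exists>a b :: 'a. a \<noteq> b"
proof (rule ccontr)
  assume "\<not> ?thesis"
  then have "x (n + 1) = x n" for n by blast
  then have "ultimately_periodic x"
    unfolding ultimately_periodic_def by (intro exI[of _ 1]) auto
  with aperiodic show False ..
qed

lemma primitive_power: obtains N where "0 < N" "\<forall>a b. a \<in> set ((\<phi> ^^ N) [b])"
proof -
  obtain N where N: "\<forall>a b. a \<in> set ((\<phi> ^^ N) [b])"
    using primitive by (auto simp: primitive_morphism_def)
  obtain a b :: 'a where "a \<noteq> b" using two_letters by blast
  then have "0 < N" using N by (cases N) auto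
  with N show ?thesis using that by blast
qed

lemma nonerasing: "0 < length (\<phi> [b])"
proof (rule ccontr)
  assume "\<not> ?thesis"
  then have b: "\<phi> [b] = []" by simp
  obtain N where N: "0 < N" "\<forall>a b. a \<in> set ((\<phi> ^^ N) [b])"
    by (rule primitive_power)
  obtain M where M: "N = Suc M" using N(1) gr0_conv_Suc by auto
  have "(\<phi> ^^ N) [b] = (\<phi> ^^ M) []" unfolding M funpow_Suc_right by (simp add: b)
  also have "\<dots> = []" by (rule morphism_Nil[OF morphism_funpow[OF hom]])
  finally show False using N(2) by (metis empty_iff list.set(1))
qed

lemma length_image: "length l \<le> length (\<phi> l)"
proof (induction l)
  case (Cons a l)
  then show ?case
    using morphism_append[OF hom, of "[a]" l] nonerasing[of a] by (simp del: length_greater_0_conv)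
qed simp

lemma length_image_prefix: "m \<le> length (\<phi> (map u [0..<m]))"
  using length_image[of "map u [0..<m]"] by simp

text \<open>If all images had length 1, so would all iterated images, but those under a primitive
  power contain two letters. This strictness later gives \<kappa> < 1.\<close>

lemma long_image_letter: "\<exists>a. 1 < length (\<phi> [a])"
proof (rule ccontr)
  assume "\<not> ?thesis"
  then have one: "length (\<phi> [a]) = 1" for a using nonerasing[of a] by (metis One_nat_def Suc_lessI)
  have len: "length (\<phi> l) = length l" for l
  proof (induction l)
    case (Cons a l)
    then show ?case using morphism_append[OF hom, of "[a]" l] one[of a] by simp
  qed (simp add: morphism_Nil[OF hom])
  have "length ((\<phi> ^^ n) [b]) = 1" for n b
    by (induction n) (simp_all add: len)
  moreover obtain N where N: "0 < N" "\<forall>a b. a \<in> set ((\<phi> ^^ N) [b])"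
    by (rule primitive_power)
  moreover obtain a b :: 'a where \<open>a \<noteq> b\<close> using two_letters by blast
  ultimately have "a \<in> set ((\<phi> ^^ N) [a])" "b \<in> set ((\<phi> ^^ N) [a])" "length ((\<phi> ^^ N) [a]) = 1"
    by blast+
  then show False using \<open>a \<noteq> b\<close> by (auto simp: length_Suc_conv)
qed

lemma \<Phi>_nth: "i < length (\<phi> (map u [0..<m])) \<Longrightarrow> \<Phi> u i = \<phi> (map u [0..<m]) ! i"
  by (rule inf_image_nth[OF hom])

lemma \<Phi>_first: "p < length (\<phi> [u 0]) \<Longrightarrow> \<Phi> u p = \<phi> [u 0] ! p"
  using \<Phi>_nth[of p u 1] by simp

lemma \<Phi>_shift: "(shift ^^ length (\<phi> (map u [0..<m]))) (\<Phi> u) = \<Phi> ((shift ^^ m) u)"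
proof
  fix i
  let ?l = "length (\<phi> (map u [0..<m]))" and ?v = "\<lambda>i. u (m + i)"
  have i: "i < length (\<phi> (map ?v [0..<Suc i]))"
    using length_image_prefix[of "Suc i" ?v] by linarith
  have "\<Phi> u (?l + i) = \<phi> (map u [0..<m + Suc i]) ! (?l + i)"
    by (rule \<Phi>_nth) (unfold morphism_prefix_add[OF hom] length_append, use i in linarith)
  also have "\<dots> = \<phi> (map ?v [0..<Suc i]) ! i"
    unfolding morphism_prefix_add[OF hom] by simp
  also have "\<dots> = \<Phi> ?v i" by (rule \<Phi>_nth[OF i, symmetric])
  finally show "(shift ^^ ?l) (\<Phi> u) i = \<Phi> ((shift ^^ m) u) i"
    by (simp add: shift_funpow)
qed

lemma \<Phi>_shift_first: "(shift ^^ length (\<phi> [u 0])) (\<Phi> u) = \<Phi> (shift u)"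
  using \<Phi>_shift[of u 1] by simp

lemma \<Phi>_agree:
  assumes "\<forall>i<n. u i = v i" and "i < n"
  shows "\<Phi> u i = \<Phi> v i"
proof -
  have eq: "map u [0..<n] = map v [0..<n]" using assms(1) by simp
  have "i < length (\<phi> (map u [0..<n]))" using length_image_prefix[of n u] assms(2) by linarith
  then show ?thesis using \<Phi>_nth[of i u n] \<Phi>_nth[of i v n] eq by simp
qed

section \<open>The subshift and its images under the morphism\<close>

lemma mem_L: "u \<in> L \<longleftrightarrow> (\<forall>n. \<exists>m. \<forall>i<n. u i = x (m + i))"
  by (simp add: L_eq orbit_closure_iff)

lemma L_closed:
  assumes "\<And>n. \<exists>y\<in>L. \<forall>i<n. y i = w i"
  shows "w \<in> L"
  unfolding mem_L
proof
  fix n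
  obtain y where y: "y \<in> L" "\<forall>i<n. y i = w i" using assms by blast
  then obtain m where "\<forall>i<n. y i = x (m + i)" using mem_L by blast
  then show "\<exists>m. \<forall>i<n. w i = x (m + i)" using y by auto
qed

lemma cyl_closed:
  assumes "\<And>n. \<exists>y\<in>cyl a. \<forall>i<n. y i = w i"
  shows "w \<in> cyl a"
proof -
  have "w \<in> L" by (rule L_closed) (use assms cylD in blast)
  moreover have "w 0 = a" using assms[of 1] by (auto simp: cyl_def)
  ultimately show ?thesis by (simp add: cyl_def)
qed

lemma x_in_L: "x \<in> L"
  unfolding mem_L by (intro allI exI[of _ 0]) simp

lemma shift_in_L: "u \<in> L \<Longrightarrow> shift u \<in> L"
proof -
  assume "u \<in> L"
  have "\<exists>m. \<forall>i<n. u (Suc i) = x (m + i)" for n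
  proof -
    obtain m where "\<forall>i<Suc n. u i = x (m + i)" using \<open>u \<in> L\<close> mem_L by blast
    then show ?thesis by (intro exI[of _ "Suc m"]) auto
  qed
  then show ?thesis by (simp add: mem_L shift_def)
qed

lemma shift_funpow_in_L: "u \<in> L \<Longrightarrow> (shift ^^ n) u \<in> L"
  by (induction n) (auto intro: shift_in_L)

text \<open>If a prefix of \<open>u\<close> occurs in \<open>x\<close> at position m, a prefix of
  \<open>\<Phi> u\<close> occurs in \<open>\<Phi> x\<close> = \<open>x\<close> at the position where
  the image of the first m letters of \<open>x\<close> ends.\<close>

lemma \<Phi>_in_L:
  assumes "u \<in> L" shows "\<Phi> u \<in> L"
  unfolding mem_L
proof
  fix n
  obtain m where m: "\<forall>i<n. u i = x (m + i)" using assms mem_L by blast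
  have "\<Phi> u i = x (length (\<phi> (map x [0..<m])) + i)" if "i < n" for i
  proof -
    have "\<Phi> u i = \<Phi> ((shift ^^ m) x) i"
      by (rule \<Phi>_agree[OF _ that]) (use m in \<open>simp add: shift_funpow\<close>)
    also have "\<dots> = (shift ^^ length (\<phi> (map x [0..<m]))) (\<Phi> x) i"
      by (simp add: \<Phi>_shift)
    finally show ?thesis by (simp add: fixed_point shift_funpow)
  qed
  then show "\<exists>m. \<forall>i<n. \<Phi> u i = x (m + i)" by blast
qed

lemma F_in_L: "u \<in> L \<Longrightarrow> F p u \<in> L"
  unfolding F_def by (intro shift_funpow_in_L \<Phi>_in_L)

lemma F_0: "F 0 u = \<Phi> u"
  by (simp add: F_def)

lemma shift_F: "shift (F p u) = F (Suc p) u"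
  by (simp add: F_def)

lemma F_first: "p < length (\<phi> [u 0]) \<Longrightarrow> F p u 0 = \<phi> [u 0] ! p"
  by (simp add: F_def shift_funpow \<Phi>_first)

lemma F_length: "F (length (\<phi> [u 0])) u = F 0 (shift u)"
  by (simp add: F_def \<Phi>_shift_first)

lemma decomposition_unique: "u \<in> L \<Longrightarrow> \<exists>!d. decomposition \<phi> L u d"
  using separable by (simp add: separable_def has_type_def)

lemma decompose:
  assumes "u \<in> L"
  obtains v p where "v \<in> L" "p < length (\<phi> [v 0])" "u = F p v"
  using decomposition_unique[OF assms] unfolding decomposition_def F_def by blast

lemma decomposition_F:
  "v \<in> L \<Longrightarrow> p < length (\<phi> [v 0]) \<Longrightarrow> decomposition \<phi> L (F p v) (v, p)"
  by (simp add: decomposition_def F_def)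

lemma F_eqD:
  assumes "u \<in> L" "p < length (\<phi> [u 0])" "v \<in> L" "q < length (\<phi> [v 0])" "F p u = F q v"
  shows "u = v" "p = q"
proof -
  have "(u, p) = (v, q)"
    using decomposition_unique[OF F_in_L[OF assms(1)], of p]
      decomposition_F[OF assms(1,2)] decomposition_F[OF assms(3,4)] assms(5) by auto
  then show "u = v" "p = q" by auto
qed

lemma type_of_F:
  assumes "v \<in> L" "p < length (\<phi> [v 0])"
  shows "type_of \<phi> L (F p v) = (v 0, p)"
proof -
  have "(THE d. decomposition \<phi> L (F p v) d) = (v, p)"
    using decomposition_unique[OF F_in_L[OF assms(1)]] decomposition_F[OF assms]
    by (intro the1_equality)
  then show ?thesis by (simp add: type_of_def)
qed

section \<open>Comparison of words through their types\<close>

lemma less_funpow_shift: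
  assumes "\<And>i. i < p \<Longrightarrow> f i = g i"
  shows "less_fun ((shift ^^ p) f) ((shift ^^ p) g) \<longleftrightarrow> less_fun f g"
proof
  assume "less_fun ((shift ^^ p) f) ((shift ^^ p) g)"
  then obtain k where k: "f (p + k) < g (p + k)" "\<And>i. i < k \<Longrightarrow> f (p + i) = g (p + i)"
    by (auto simp: shift_funpow elim!: less_funE)
  have "f i = g i" if "i < p + k" for i
    using assms[of i] k(2)[of "i - p"] that by (cases "i < p") auto
  with k(1) show "less_fun f g" by (auto simp: less_fun_def)
next
  assume "less_fun f g"
  then obtain k where k: "f k < g k" "\<And>i. i < k \<Longrightarrow> f i = g i" by (blast elim!: less_funE)
  have "p \<le> k" using assms[of k] k(1) by (metis less_irrefl not_less)
  then show "less_fun ((shift ^^ p) f) ((shift ^^ p) g)"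
    using k by (auto simp: less_fun_def shift_funpow intro!: exI[of _ "k - p"])
qed

text \<open>Equal first letters make the two images agree on more than p positions, so erasing p
  letters does not affect the comparison, and order preservation applies.\<close>

lemma F_less_same:
  assumes "u \<in> L" "v \<in> L" "u 0 = v 0" "p < length (\<phi> [v 0])"
  shows "less_fun (F p u) (F p v) \<longleftrightarrow> less_fun u v"
proof -
  have "\<Phi> u i = \<Phi> v i" if "i < p" for i
    using that assms(3,4) by (simp add: \<Phi>_first)
  then have "less_fun (F p u) (F p v) \<longleftrightarrow> less_fun (\<Phi> u) (\<Phi> v)"
    unfolding F_def by (rule less_funpow_shift)
  then show ?thesis using order_preserving assms(1,2) by (simp add: order_preserving_on_def)
qed

lemma types_iff: "(a, p) \<in> types \<phi> \<longleftrightarrow> p < length (\<phi> [a])"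
  by (simp add: types_def)

lemma finite_types: "finite (types \<phi>)"
proof -
  have "types \<phi> = (\<Union>a. Pair a ` {..<length (\<phi> [a])})" by (auto simp: types_def)
  then show ?thesis by simp
qed

lemma r_irrefl: "(s, s) \<notin> r" and r_trans: "(s, t) \<in> r \<Longrightarrow> (t, t') \<in> r \<Longrightarrow> (s, t') \<in> r"
  and r_total: "s \<in> types \<phi> \<Longrightarrow> t \<in> types \<phi> \<Longrightarrow> s = t \<or> (s, t) \<in> r \<or> (t, s) \<in> r"
  using type_order unfolding type_order_def strict_linear_order_on_def irrefl_def total_on_def
  by (blast dest: transD)+

lemma r_asym: "(s, t) \<in> r \<Longrightarrow> (t, s) \<notin> r"
  using r_irrefl r_trans by blast

lemma F_less_types:
  assumes "u \<in> L" "p < length (\<phi> [u 0])" "v \<in> L" "q < length (\<phi> [v 0])"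
    and "((u 0, p), (v 0, q)) \<in> r"
  shows "less_fun (F p u) (F q v)"
  using type_order assms by (simp add: type_order_def F_in_L type_of_F)

text \<open>Along the bijection (u, p) \<mapsto> \<open>F p u\<close> the order of L becomes
  lexicographic: first the type under \<open>r\<close>, then the desubstituted word. Totality of
  \<open>r\<close> turns the one-sided separability condition into an equivalence.\<close>

lemma F_less_iff:
  assumes "u \<in> L" "p < length (\<phi> [u 0])" "v \<in> L" "q < length (\<phi> [v 0])"
  shows "less_fun (F p u) (F q v) \<longleftrightarrow>
    ((u 0, p), (v 0, q)) \<in> r \<or> u 0 = v 0 \<and> p = q \<and> less_fun u v"
proof (cases "(u 0, p) = (v 0, q)")
  case True
  then show ?thesis using F_less_same[of u v p] assms r_irrefl by auto
next
  case False
  then have "((u 0, p), (v 0, q)) \<in> r \<or> ((v 0, q), (u 0, p)) \<in> r"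
    using r_total[of "(u 0, p)" "(v 0, q)"] assms by (auto simp: types_iff)
  then show ?thesis
    using False F_less_types[of u p v q] F_less_types[of v q u p] assms less_fun_asym r_asym by auto
qed

lemma F_le_iff:
  assumes "u \<in> L" "p < length (\<phi> [u 0])" "v \<in> L" "q < length (\<phi> [v 0])"
  shows "lex_le (F p u) (F q v) \<longleftrightarrow>
    ((u 0, p), (v 0, q)) \<in> r \<or> u 0 = v 0 \<and> p = q \<and> lex_le u v"
  unfolding lex_le_def F_less_iff[OF assms] using F_eqD[OF assms] by auto

text \<open>The type of \<open>y\<close> lies weakly between those of the two outer words; these
  coincide, so \<open>y\<close> has the same type.\<close>

lemma F_convex:
  assumes "u \<in> L" "v \<in> L" "u 0 = v 0" "p < length (\<phi> [v 0])" and "y \<in> L"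
    and "less_fun (F p u) y" "less_fun y (F p v)"
  obtains w where "w \<in> L" "w 0 = v 0" "y = F p w" "less_fun u w" "less_fun w v"
proof -
  obtain w q where w: "w \<in> L" "q < length (\<phi> [w 0])" "y = F q w" using decompose[OF \<open>y \<in> L\<close>] .
  have "(w 0, q) = (v 0, p)"
    using assms w r_asym by (auto simp: F_less_iff)
  with w assms show ?thesis by (intro that[of w]) (auto simp: F_less_same)
qed

subsection \<open>Measurability\<close>

abbreviation \<B> :: "(nat \<Rightarrow> 'a) measure" where
  "\<B> \<equiv> restrict_space (PiM UNIV (\<lambda>_. count_space UNIV)) L"

lemma space_\<B>: "space \<B> = L"
  by (simp add: space_restrict_space space_PiM)

definition prefix_set :: "'a list \<Rightarrow> (nat \<Rightarrow> 'a) set" where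
  "prefix_set l = {y \<in> L. \<forall>i<length l. y i = l ! i}"

lemma prefix_set_sets: "prefix_set l \<in> sets \<B>"
proof -
  let ?M = "PiM UNIV (\<lambda>_. count_space UNIV) :: (nat \<Rightarrow> 'a) measure"
  have "{y \<in> space ?M. \<forall>i\<in>{..<length l}. y i = l ! i} \<in> sets ?M"
    by measurable
  moreover have "prefix_set l = L \<inter> {y \<in> space ?M. \<forall>i\<in>{..<length l}. y i = l ! i}"
    by (auto simp: prefix_set_def space_PiM)
  ultimately show ?thesis by (auto simp: sets_restrict_space)
qed

lemma mem_prefix_set: "y \<in> prefix_set (map u [0..<n]) \<longleftrightarrow> y \<in> L \<and> (\<forall>i<n. y i = u i)"
  by (auto simp: prefix_set_def)

lemma cyl_eq: "cyl a = prefix_set [a]"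
  by (auto simp: cyl_def prefix_set_def)

lemma cyl_sets: "cyl a \<in> sets \<B>"
  by (simp add: cyl_eq prefix_set_sets)

lemma singleton_sets:
  assumes "u \<in> L" shows "{u} \<in> sets \<B>"
proof -
  have "{u} = (\<Inter>n. prefix_set (map u [0..<n]))"
    using assms by (auto simp: mem_prefix_set fun_eq_iff) (blast intro: lessI)
  also have "\<dots> \<in> sets \<B>" using prefix_set_sets by (intro sets.countable_INT) auto
  finally show ?thesis .
qed

text \<open>
  A point of \<open>D\<close> below another point of \<open>D\<close> has a neighbourhood in \<open>D\<close>; so all points of \<open>D\<close>
  except possibly the greatest are covered by the countably many cylinders inside \<open>D\<close>.
\<close>

lemma down_closed_sets:
  assumes "D \<subseteq> L" and down: "\<And>y z. z \<in> D \<Longrightarrow> y \<in> L \<Longrightarrow> less_fun y z \<Longrightarrow> y \<in> D"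
  shows "D \<in> sets \<B>"
proof -
  define U where "U = (\<Union>l\<in>{l. prefix_set l \<subseteq> D}. prefix_set l)"
  have U: "U \<in> sets \<B>"
    unfolding U_def by (intro sets.countable_UN'' prefix_set_sets) auto
  have greatest: "lex_le z y" if "y \<in> D - U" "z \<in> D" for y z
  proof (rule ccontr)
    assume "\<not> lex_le z y"
    then obtain n where n: "\<forall>v. (\<forall>i<n. v i = y i) \<longrightarrow> less_fun v z"
      unfolding not_lex_le by (rule less_fun_open_left)
    then have "prefix_set (map y [0..<n]) \<subseteq> D"
      using n down[OF that(2)] by (auto simp: mem_prefix_set)
    moreover have "y \<in> prefix_set (map y [0..<n])"
      using that assms(1) by (auto simp: mem_prefix_set)
    ultimately show False using that by (auto simp: U_def)
  qed
  have "D - U \<in> sets \<B>"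
  proof (cases "D - U = {}")
    case False
    then obtain y where y: "y \<in> D - U" by blast
    then have "D - U = {y}" using greatest lex_le_antisym by blast
    then show ?thesis using singleton_sets y assms(1) by auto
  next
    case True
    show ?thesis unfolding True by simp
  qed
  moreover have "D = U \<union> (D - U)" by (auto simp: U_def)
  ultimately show ?thesis using U by (metis sets.Un)
qed

text \<open>A convex set is the difference of two down-closed ones: the words below some element of
  it, minus the words strictly below all its elements.\<close>

lemma convex_sets:
  assumes "C \<subseteq> L"
    and convex: "\<And>y z w. y \<in> C \<Longrightarrow> w \<in> C \<Longrightarrow> z \<in> L \<Longrightarrow> less_fun y z \<Longrightarrow> less_fun z w \<Longrightarrow> z \<in> C"
  shows "C \<in> sets \<B>"
proof -
  define D E where "D = {y \<in> L. \<exists>z\<in>C. lex_le y z}" and "E = {y \<in> L. \<forall>z\<in>C. less_fun y z}"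
  have "D \<in> sets \<B>"
    by (rule down_closed_sets) (auto simp: D_def lex_le_def intro: less_fun_trans)
  moreover have "E \<in> sets \<B>"
    by (rule down_closed_sets) (auto simp: E_def intro: less_fun_trans)
  moreover have "C = D - E"
  proof
    show "C \<subseteq> D - E" using assms(1) less_fun_irrefl lex_le_refl unfolding D_def E_def by blast
    show "D - E \<subseteq> C"
    proof
      fix y assume "y \<in> D - E"
      then obtain z w where "y \<in> L" "z \<in> C" "lex_le y z" "w \<in> C" "lex_le w y"
        unfolding D_def E_def by (auto simp: not_less_fun)
      then show "y \<in> C" unfolding lex_le_def using convex by blast
    qed
  qed
  ultimately show ?thesis by blast
qed

text \<open>Induction over the generated \<sigma>-algebra. A generator, which constrains one
  coordinate, splits into prefix sets; these are convex, and \<open>F p\<close> sends convex subsets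
  of \<open>cyl b\<close> to convex sets. Complements pass through by injectivity.\<close>

lemma F_image_sets:
  assumes "A \<in> sets \<B>" and p: "p < length (\<phi> [b])"
  shows "F p ` (A \<inter> cyl b) \<in> sets \<B>"
proof -
  have convex: "F p ` C \<in> sets \<B>"
    if "C \<subseteq> cyl b"
      "\<And>y z w. y \<in> C \<Longrightarrow> w \<in> C \<Longrightarrow> z \<in> cyl b \<Longrightarrow> less_fun y z \<Longrightarrow> less_fun z w \<Longrightarrow> z \<in> C" for C
  proof (rule convex_sets)
    show "F p ` C \<subseteq> L" using that(1) by (auto simp: cyl_def intro!: F_in_L)
    fix y z w assume "y \<in> F p ` C" "w \<in> F p ` C" "z \<in> L" "less_fun y z" "less_fun z w"
    then obtain u v where uv: "u \<in> C" "v \<in> C" "less_fun (F p u) z" "less_fun z (F p v)" by blast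
    have "u \<in> cyl b" "v \<in> cyl b" using uv that(1) by auto
    then obtain t where "t \<in> L" "t 0 = b" "z = F p t" "less_fun u t" "less_fun t v"
      using uv p \<open>z \<in> L\<close> by (auto simp: cyl_def elim: F_convex)
    then show "z \<in> F p ` C" using that(2)[of u v t] uv by (auto simp: cyl_def)
  qed
  have cyl_convex: "z \<in> prefix_set l"
    if "y \<in> prefix_set l" "w \<in> prefix_set l" "z \<in> L" "less_fun y z" "less_fun z w" for l y z w
  proof -
    have eq: "y i = w i" if "i < length l" for i
      using \<open>y \<in> prefix_set l\<close> \<open>w \<in> prefix_set l\<close> that
      by (auto simp: prefix_set_def)
    obtain k where k: "y k < z k" "\<And>i. i < k \<Longrightarrow> y i = z i" using \<open>less_fun y z\<close> by (blast elim!: less_funE)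
    obtain j where j: "z j < w j" "\<And>i. i < j \<Longrightarrow> z i = w i" using \<open>less_fun z w\<close> by (blast elim!: less_funE)
    have "length l \<le> k"
    proof (rule ccontr)
      assume "\<not> length l \<le> k"
      then have "y k = w k" using eq by simp
      then show False
        using k j eq \<open>\<not> length l \<le> k\<close>
        by (metis linorder_neqE_nat not_less_iff_gr_or_eq not_less order.strict_trans)
    qed
    then have "z i = y i" if "i < length l" for i using k(2)[of i] that by simp
    then show ?thesis using \<open>y \<in> prefix_set l\<close> \<open>z \<in> L\<close> by (auto simp: prefix_set_def)
  qed
  have inj: "inj_on (F p) (cyl b)"
    using p by (intro inj_onI) (auto simp: cyl_def dest: F_eqD)
  have all: "F p ` cyl b \<in> sets \<B>" by (rule convex) auto
  obtain X where X: "X \<in> sets (PiM UNIV (\<lambda>_. count_space UNIV))" "A = L \<inter> X"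
    using assms(1) by (auto simp: sets_restrict_space)
  have "F p ` (X \<inter> cyl b) \<in> sets \<B>"
    using X(1)[unfolded sets_PiM_single]
  proof induction
    case (Basic X)
    then obtain i S where X: "X = {f. f i \<in> S}" by auto
    have "X \<inter> cyl b = (\<Union>l\<in>{l. length l = Suc i \<and> l ! i \<in> S}. prefix_set l \<inter> cyl b)"
      unfolding X
    proof safe
      fix f assume "f i \<in> S" "f \<in> cyl b"
      then show "f \<in> (\<Union>l\<in>{l. length l = Suc i \<and> l ! i \<in> S}. prefix_set l \<inter> cyl b)"
        by (intro UN_I[of "map f [0..<Suc i]"])
          (auto simp: prefix_set_def cyl_def simp del: upt_Suc)
    next
      fix f l assume "f \<in> prefix_set l" "length l = Suc i" "l ! i \<in> S"
      then show "f i \<in> S" by (auto simp: prefix_set_def)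
    qed
    then have "F p ` (X \<inter> cyl b) =
        (\<Union>l\<in>{l. length l = Suc i \<and> l ! i \<in> S}. F p ` (prefix_set l \<inter> cyl b))"
      by (simp only: image_UN)
    also have "\<dots> \<in> sets \<B>"
      by (intro sets.countable_UN'' convex) (auto simp: cyl_def intro: cyl_convex)
    finally show ?case .
  next
    case Empty
    then show ?case by simp
  next
    case (Compl X)
    have "F p ` ((UNIV - X) \<inter> cyl b) = F p ` (cyl b - X \<inter> cyl b)" by (rule arg_cong) auto
    also have "\<dots> = F p ` cyl b - F p ` (X \<inter> cyl b)"
      by (rule inj_on_image_set_diff[OF inj]) auto
    finally show ?case using Compl all by auto
  next
    case (Union X)
    have "F p ` (\<Union> (range X) \<inter> cyl b) = (\<Union>i. F p ` (X i \<inter> cyl b))" by auto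
    then show ?case using Union by auto
  qed
  moreover have "A \<inter> cyl b = X \<inter> cyl b" using X(2) by (auto simp: cyl_def)
  ultimately show ?thesis by simp
qed

lemma \<Phi>_image_eq: "A \<subseteq> L \<Longrightarrow> \<Phi> ` A = (\<Union>b. F 0 ` (A \<inter> cyl b))"
  by (auto simp: F_0 cyl_def)

lemma \<Phi>_image_sets:
  assumes "A \<in> sets \<B>" shows "\<Phi> ` A \<in> sets \<B>"
proof -
  have "A \<subseteq> L" using sets.sets_into_space[OF assms] by (simp add: space_\<B>)
  then show ?thesis
    using F_image_sets[OF assms nonerasing] by (auto simp: \<Phi>_image_eq intro!: sets.finite_UN)
qed

section \<open>Shift-invariant contents\<close>

text \<open>The iterates of \<open>desubst\<close> lose total mass, so they are not probabilities.
  Nonnegative, finitely additive, invariant set functions form a class that \<open>desubst\<close>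
  preserves.\<close>

definition content :: "((nat \<Rightarrow> 'a) set \<Rightarrow> real) \<Rightarrow> bool" where
  "content m \<longleftrightarrow> (\<forall>A\<in>sets \<B>. 0 \<le> m A) \<and>
    (\<forall>A\<in>sets \<B>. \<forall>B\<in>sets \<B>. A \<inter> B = {} \<longrightarrow> m (A \<union> B) = m A + m B) \<and>
    (\<forall>A\<in>sets \<B>. m {y \<in> L. shift y \<in> A} = m A)"

text \<open>L is a tower with base \<phi>(L) and levels \<open>F p\<close>. This is the content
  restricted to the base and transported back to L by \<phi>, under which the first return to the
  base becomes the shift.\<close>

definition desubst :: "((nat \<Rightarrow> 'a) set \<Rightarrow> real) \<Rightarrow> (nat \<Rightarrow> 'a) set \<Rightarrow> real" where
  "desubst m A = m (\<Phi> ` A)"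

lemma content_nonneg: "content m \<Longrightarrow> A \<in> sets \<B> \<Longrightarrow> 0 \<le> m A"
  and content_Un: "content m \<Longrightarrow> A \<in> sets \<B> \<Longrightarrow> B \<in> sets \<B> \<Longrightarrow> A \<inter> B = {} \<Longrightarrow>
    m (A \<union> B) = m A + m B"
  and content_shift: "content m \<Longrightarrow> A \<in> sets \<B> \<Longrightarrow> m {y \<in> L. shift y \<in> A} = m A"
  by (simp_all add: content_def)

lemma content_empty: "content m \<Longrightarrow> m {} = 0"
  using content_Un[of m "{}" "{}"] by simp

lemma content_mono:
  assumes "content m" "A \<in> sets \<B>" "B \<in> sets \<B>" "A \<subseteq> B"
  shows "m A \<le> m B"
proof -
  have "m B = m A + m (B - A)"
    using content_Un[of m A "B - A"] assms by (simp add: Un_absorb1 sets.Diff)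
  then show ?thesis using content_nonneg[of m "B - A"] assms by (simp add: sets.Diff)
qed

lemma content_UN:
  assumes "content m" "finite I" "\<And>i. i \<in> I \<Longrightarrow> A i \<in> sets \<B>" "disjoint_family_on A I"
  shows "m (\<Union>i\<in>I. A i) = (\<Sum>i\<in>I. m (A i))"
  using assms(2-4)
proof (induction I rule: finite_induct)
  case empty
  then show ?case by (simp add: content_empty[OF assms(1)])
next
  case (insert i I)
  have "A i \<inter> (\<Union>j\<in>I. A j) = {}"
    using insert.prems(2) insert.hyps(2) by (fastforce simp: disjoint_family_on_def)
  then have "m (A i \<union> (\<Union>j\<in>I. A j)) = m (A i) + m (\<Union>j\<in>I. A j)"
    using insert.prems insert.hyps(1) by (intro content_Un[OF assms(1)] sets.finite_UN) auto
  moreover have "disjoint_family_on A I"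
    using insert.prems(2) by (auto simp: disjoint_family_on_def)
  ultimately show ?case using insert by simp
qed

lemma sets_subset_L: "A \<in> sets \<B> \<Longrightarrow> A \<subseteq> L"
  using sets.sets_into_space[of A \<B>] by (simp only: space_\<B>)

lemma L_sets: "L \<in> sets \<B>"
  using sets.top[of \<B>] by (simp only: space_\<B>)

lemma shift_preimage_sets:
  assumes "A \<in> sets \<B>" shows "{y \<in> L. shift y \<in> A} \<in> sets \<B>"
proof -
  let ?M = "PiM UNIV (\<lambda>_. count_space UNIV) :: (nat \<Rightarrow> 'a) measure"
  have meas: "shift \<in> measurable ?M ?M"
    unfolding shift_def by (rule measurable_PiM_single') (auto simp: space_PiM)
  obtain X where X: "X \<in> sets ?M" "A = L \<inter> X"
    using assms by (auto simp: sets_restrict_space)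
  have "shift -` X \<inter> space ?M \<in> sets ?M" by (rule measurable_sets[OF meas X(1)])
  moreover have "{y \<in> L. shift y \<in> A} = L \<inter> (shift -` X \<inter> space ?M)"
    using X(2) shift_in_L by (auto simp: space_PiM)
  ultimately show ?thesis by (auto simp: sets_restrict_space)
qed

lemma F_subset_sets:
  assumes "A \<in> sets \<B>" "A \<subseteq> cyl b" "p < length (\<phi> [b])"
  shows "F p ` A \<in> sets \<B>"
  using F_image_sets[OF assms(1,3)] assms(2) by (simp add: Int_absorb2)

text \<open>
  The only preimage of \<open>\<sigma>\<^sup>p\<^sup>+\<^sup>1(\<phi>(u))\<close> under the shift is \<open>\<sigma>\<^sup>p(\<phi>(u))\<close>, because another one would
  give a second decomposition.
\<close>

lemma content_F:
  assumes m: "content m" and A: "A \<in> sets \<B>" "A \<subseteq> cyl b" and "p < length (\<phi> [b])"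
  shows "m (F p ` A) = desubst m A"
  using assms(4)
proof (induction p)
  case 0
  then show ?case by (simp add: F_0 desubst_def image_def)
next
  case (Suc p)
  have "{y \<in> L. shift y \<in> F (Suc p) ` A} = F p ` A"
  proof safe
    fix y u assume y: "y \<in> L" "shift y = F (Suc p) u" "u \<in> A"
    then have u: "u \<in> L" "u 0 = b" using A by (auto simp: cyl_def)
    obtain v q where v: "v \<in> L" "q < length (\<phi> [v 0])" "y = F q v" using decompose[OF y(1)] .
    show "y \<in> F p ` A"
    proof (cases "Suc q < length (\<phi> [v 0])")
      case True
      then have "v = u" "Suc q = Suc p"
        using F_eqD[of v "Suc q" u "Suc p"] y v u Suc.prems by (simp_all add: shift_F)
      then show ?thesis using v y by auto
    next
      case False
      then have "Suc q = length (\<phi> [v 0])" using v by simp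
      then have "F 0 (shift v) = F (Suc p) u"
        using y(2) v(3) F_length[of v] by (simp add: shift_F)
      then have "0 = Suc p"
        by (intro F_eqD(2)[of "shift v" 0 u "Suc p"])
          (use u v Suc.prems shift_in_L nonerasing in \<open>auto simp del: length_greater_0_conv\<close>)
      then show ?thesis by simp
    qed
  qed (use A in \<open>auto simp: cyl_def shift_F intro!: F_in_L\<close>)
  then have "m (F (Suc p) ` A) = m (F p ` A)"
    using content_shift[OF m F_subset_sets[OF A Suc.prems]] by simp
  with Suc show ?case by simp
qed

lemma F_images_disjoint:
  assumes "A \<subseteq> cyl b" "p < length (\<phi> [b])" "B \<subseteq> cyl c" "q < length (\<phi> [c])"
    and "(b, p) \<noteq> (c, q)"
  shows "F p ` A \<inter> F q ` B = {}"
proof (rule ccontr)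
  assume "F p ` A \<inter> F q ` B \<noteq> {}"
  then obtain u v where uv: "u \<in> A" "v \<in> B" "F p u = F q v" by auto
  then have u: "u \<in> L" "u 0 = b" and v: "v \<in> L" "v 0 = c"
    using assms(1,3) by (auto simp: cyl_def)
  then have "u = v" "p = q" using F_eqD[of u p v q] assms(2,4) uv(3) by auto
  with u v assms(5) show False by simp
qed

text \<open>Words that the shift maps into \<phi>(A) sit on top levels: they are
  \<open>F (length (\<phi> [b]) - 1) v\<close> with \<open>v 0 = b\<close> and
  \<open>shift v\<close> in \<open>A\<close>. By \<open>content_F\<close> each such part has the
  mass of its copy on the bottom level, and these copies form the image of the preimage of
  \<open>A\<close>.\<close>

lemma desubst_content:
  assumes m: "content m" shows "content (desubst m)"
  unfolding content_def
proof (intro conjI ballI impI)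
  fix A assume A: "A \<in> sets \<B>"
  show "0 \<le> desubst m A" unfolding desubst_def by (intro content_nonneg m \<Phi>_image_sets A)
  let ?A = "{y \<in> L. shift y \<in> A}"
  have A': "?A \<in> sets \<B>" by (rule shift_preimage_sets[OF A])
  have Ab: "?A \<inter> cyl b \<in> sets \<B>" for b using A' cyl_sets by (rule sets.Int)
  let ?l = "\<lambda>b. length (\<phi> [b]) - 1"
  have l: "?l b < length (\<phi> [b])" for b using nonerasing[of b] by simp
  have "{y \<in> L. shift y \<in> \<Phi> ` A} = (\<Union>b. F (?l b) ` (?A \<inter> cyl b))"
  proof safe
    fix y u assume y: "y \<in> L" "shift y = \<Phi> u" "u \<in> A"
    then have u: "u \<in> L" using sets_subset_L[OF A] by auto
    obtain v q where v: "v \<in> L" "q < length (\<phi> [v 0])" "y = F q v" using decompose[OF y(1)] .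
    \<comment> \<open>Below the top, the shifted word would decompose with offset
      \<open>Suc q\<close>, whereas words of \<phi>(A) have offset 0.\<close>
    have "\<not> Suc q < length (\<phi> [v 0])"
      using F_eqD(2)[of v "Suc q" u 0] y v u nonerasing[of "u 0"]
      by (auto simp: shift_F F_0 simp del: length_greater_0_conv)
    then have q: "Suc q = length (\<phi> [v 0])" using v by simp
    then have "F 0 (shift v) = F 0 u"
      using y(2) v(3) F_length[of v] by (simp add: shift_F F_0)
    then have "shift v = u"
      by (intro F_eqD(1)[of "shift v" 0 u 0])
        (use u v shift_in_L nonerasing in \<open>auto simp del: length_greater_0_conv\<close>)
    then have "v \<in> ?A \<inter> cyl (v 0)" using v y by (auto simp: cyl_def)
    moreover have "y = F (?l (v 0)) v" using v(3) q by (metis diff_Suc_1)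
    ultimately show "y \<in> (\<Union>b. F (?l b) ` (?A \<inter> cyl b))" by blast
  next
    fix b u assume u: "u \<in> L" "shift u \<in> A" "u \<in> cyl b"
    then show "F (?l b) u \<in> L" by (intro F_in_L)
    have "Suc (?l b) = length (\<phi> [u 0])" using l[of b] cylD(2)[OF u(3)] by simp
    then have "shift (F (?l b) u) = \<Phi> (shift u)"
      using F_length[of u] by (simp only: shift_F F_0)
    then show "shift (F (?l b) u) \<in> \<Phi> ` A" using u(2) by auto
  qed
  then have "desubst m A = m (\<Union>b. F (?l b) ` (?A \<inter> cyl b))"
    using content_shift[OF m \<Phi>_image_sets[OF A]] by (simp add: desubst_def)
  also have "\<dots> = (\<Sum>b\<in>UNIV. m (F (?l b) ` (?A \<inter> cyl b)))"
  proof (rule content_UN[OF m])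
    show "F (?l b) ` (?A \<inter> cyl b) \<in> sets \<B>" for b
      by (rule F_subset_sets[OF Ab _ l]) auto
    show "disjoint_family_on (\<lambda>b. F (?l b) ` (?A \<inter> cyl b)) UNIV"
      unfolding disjoint_family_on_def using l by (intro ballI impI F_images_disjoint) auto
  qed simp
  also have "\<dots> = (\<Sum>b\<in>UNIV. desubst m (?A \<inter> cyl b))"
    by (intro sum.cong content_F[OF m Ab _ l]) auto
  also have "\<dots> = m (\<Union>b. F 0 ` (?A \<inter> cyl b))"
  proof -
    have "m (\<Union>b. F 0 ` (?A \<inter> cyl b)) = (\<Sum>b\<in>UNIV. m (F 0 ` (?A \<inter> cyl b)))"
    proof (rule content_UN[OF m])
      show "F 0 ` (?A \<inter> cyl b) \<in> sets \<B>" for b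
        by (rule F_subset_sets[OF Ab _ nonerasing]) auto
      show "disjoint_family_on (\<lambda>b. F 0 ` (?A \<inter> cyl b)) UNIV"
        unfolding disjoint_family_on_def using nonerasing
        by (intro ballI impI F_images_disjoint) auto
    qed simp
    then show ?thesis by (simp add: desubst_def F_0 image_def)
  qed
  also have "\<dots> = desubst m ?A"
    unfolding desubst_def by (subst \<Phi>_image_eq) auto
  finally show "desubst m ?A = desubst m A" by simp
next
  fix A B assume AB: "A \<in> sets \<B>" "B \<in> sets \<B>" "A \<inter> B = {}"
  have "\<Phi> ` A \<inter> \<Phi> ` B = {}"
  proof (rule ccontr)
    assume "\<Phi> ` A \<inter> \<Phi> ` B \<noteq> {}"
    then obtain u v where uv: "u \<in> A" "v \<in> B" "F 0 u = F 0 v" by (auto simp: F_0)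
    then have "u = v"
      using F_eqD(1)[of u 0 v 0] AB(1,2) sets_subset_L nonerasing by blast
    then show False using uv AB(3) by auto
  qed
  then show "desubst m (A \<union> B) = desubst m A + desubst m B"
    unfolding desubst_def image_Un using AB by (intro content_Un m \<Phi>_image_sets)
qed

lemma desubst_pow_content: "content m \<Longrightarrow> content ((desubst ^^ k) m)"
  by (induction k) (auto intro: desubst_content)

text \<open>The family \<open>A\<close> varies with the type because initial segments of L consist
  of full levels and one partial level.\<close>

lemma content_tower:
  assumes m: "content m" and T: "T \<subseteq> types \<phi>"
    and A: "\<And>t. t \<in> T \<Longrightarrow> A t \<in> sets \<B>" "\<And>t. t \<in> T \<Longrightarrow> A t \<subseteq> cyl (fst t)"
  shows "m (\<Union>t\<in>T. F (snd t) ` A t) = (\<Sum>t\<in>T. desubst m (A t))"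
proof -
  have t: "snd t < length (\<phi> [fst t])" if "t \<in> T" for t
    using that T by (cases t) (auto simp: types_def)
  have "m (\<Union>t\<in>T. F (snd t) ` A t) = (\<Sum>t\<in>T. m (F (snd t) ` A t))"
  proof (rule content_UN[OF m])
    show "finite T" using finite_types T finite_subset by blast
    show "F (snd t) ` A t \<in> sets \<B>" if "t \<in> T" for t
      by (rule F_subset_sets[OF A t]) (use that in auto)
    show "disjoint_family_on (\<lambda>t. F (snd t) ` A t) T"
      unfolding disjoint_family_on_def
      using t A(2) by (intro ballI impI F_images_disjoint) (auto simp: prod_eq_iff)
  qed
  also have "\<dots> = (\<Sum>t\<in>T. desubst m (A t))"
    by (intro sum.cong content_F[OF m A t]) auto
  finally show ?thesis .
qed

section \<open>Letter vectors and the incidence matrix\<close>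

lemma content_letters:
  assumes "content m" "A \<in> sets \<B>"
  shows "m A = (\<Sum>b\<in>UNIV. m (A \<inter> cyl b))"
proof -
  have "A = (\<Union>b. A \<inter> cyl b)" using sets_subset_L[OF assms(2)] by (auto simp: cyl_def)
  then have "m A = m (\<Union>b. A \<inter> cyl b)" by simp
  also have "\<dots> = (\<Sum>b\<in>UNIV. m (A \<inter> cyl b))"
    using assms cyl_sets by (intro content_UN) (auto simp: disjoint_family_on_def cyl_def)
  finally show ?thesis .
qed

lemma content_total: "content m \<Longrightarrow> m L = (\<Sum>b\<in>UNIV. m (cyl b))"
  using content_letters[OF _ L_sets] by (simp add: cyl_def Int_def cong: conj_cong)

text \<open>With \<open>S\<close> a single letter the coefficients are entries of the incidence
  matrix; with \<open>S = UNIV\<close> they are the lengths of the images.\<close>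

lemma sum_over_types: "(\<Sum>t | t \<in> types \<phi> \<and> \<phi> [fst t] ! snd t \<in> S. f (fst t)) =
    (\<Sum>b\<in>UNIV. real (card {p. p < length (\<phi> [b]) \<and> \<phi> [b] ! p \<in> S}) * f b)"
proof -
  have "{t. t \<in> types \<phi> \<and> \<phi> [fst t] ! snd t \<in> S} =
      Sigma UNIV (\<lambda>b. {p. p < length (\<phi> [b]) \<and> \<phi> [b] ! p \<in> S})"
    by (auto simp: types_def)
  then have "(\<Sum>t | t \<in> types \<phi> \<and> \<phi> [fst t] ! snd t \<in> S. f (fst t)) =
      (\<Sum>(b, p)\<in>Sigma UNIV (\<lambda>b. {p. p < length (\<phi> [b]) \<and> \<phi> [b] ! p \<in> S}). f b)"
    by (simp add: case_prod_unfold)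
  also have "\<dots> = (\<Sum>b\<in>UNIV. \<Sum>p | p < length (\<phi> [b]) \<and> \<phi> [b] ! p \<in> S. f b)"
    by (rule sum.Sigma[symmetric]) auto
  finally show ?thesis by simp
qed

text \<open>The words starting with \<open>a\<close> fill exactly the levels (b, p) for which the
  letter of \<phi>(b) at position p is \<open>a\<close>, and every level over b has mass
  \<open>desubst m (cyl b)\<close>.\<close>

lemma content_letter:
  assumes m: "content m"
  shows "m (cyl a) = (\<Sum>b\<in>UNIV. real (count_list (\<phi> [b]) a) * desubst m (cyl b))"
proof -
  let ?T = "{t. t \<in> types \<phi> \<and> \<phi> [fst t] ! snd t \<in> {a}}"
  have "cyl a = (\<Union>t\<in>?T. F (snd t) ` cyl (fst t))"
  proof safe
    fix y assume "y \<in> cyl a"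
    then obtain v q where v: "v \<in> L" "q < length (\<phi> [v 0])" "y = F q v"
      by (auto simp: cyl_def elim: decompose)
    then show "y \<in> (\<Union>t\<in>?T. F (snd t) ` cyl (fst t))"
      using \<open>y \<in> cyl a\<close> by (intro UN_I[of "(v 0, q)"]) (auto simp: types_iff cyl_def F_first)
  qed (auto simp: types_iff cyl_def F_first F_in_L)
  then have "m (cyl a) = m (\<Union>t\<in>?T. F (snd t) ` cyl (fst t))" by simp
  also have "\<dots> = (\<Sum>t\<in>?T. desubst m (cyl (fst t)))"
    by (rule content_tower[OF m]) (auto simp: cyl_sets)
  also have "\<dots> = (\<Sum>b\<in>UNIV. real (card {p. p < length (\<phi> [b]) \<and> \<phi> [b] ! p \<in> {a}}) *
      desubst m (cyl b))"
    by (rule sum_over_types)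
  finally show ?thesis
    by (simp add: count_list_eq_length_filter length_filter_conv_card eq_commute[of a])
qed

lemma content_total_desubst:
  assumes m: "content m"
  shows "m L = (\<Sum>b\<in>UNIV. real (length (\<phi> [b])) * desubst m (cyl b))"
proof -
  have "L = (\<Union>t\<in>types \<phi>. F (snd t) ` cyl (fst t))"
  proof safe
    fix y assume "y \<in> L"
    then obtain v q where v: "v \<in> L" "q < length (\<phi> [v 0])" "y = F q v"
      by (rule decompose)
    then show "y \<in> (\<Union>t\<in>types \<phi>. F (snd t) ` cyl (fst t))"
      by (intro UN_I[of "(v 0, q)"]) (auto simp: types_iff cyl_def)
  qed (auto simp: cyl_def F_in_L)
  then have "m L = m (\<Union>t\<in>types \<phi>. F (snd t) ` cyl (fst t))" by simp
  also have "\<dots> = (\<Sum>t\<in>types \<phi>. desubst m (cyl (fst t)))"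
    by (rule content_tower[OF m]) (auto simp: cyl_sets)
  also have "\<dots> = (\<Sum>b\<in>UNIV. real (length (\<phi> [b])) * desubst m (cyl b))"
    using sum_over_types[where S = UNIV] by simp
  finally show ?thesis .
qed

lemma desubst_L_pos:
  assumes m: "content m" and "0 < m L"
  shows "0 < desubst m L"
proof (rule ccontr)
  assume "\<not> ?thesis"
  then have "desubst m (cyl b) \<le> 0" for b
    using content_mono[OF desubst_content[OF m] cyl_sets L_sets, of b] by (auto simp: cyl_def)
  then have "m L \<le> 0"
    unfolding content_total_desubst[OF m] by (intro sum_nonpos mult_nonneg_nonpos) auto
  with \<open>0 < m L\<close> show False by simp
qed

lemma desubst_pow_L_pos: "content m \<Longrightarrow> 0 < m L \<Longrightarrow> 0 < (desubst ^^ k) m L"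
  by (induction k) (auto intro: desubst_L_pos desubst_pow_content)

lemma content_letter_pow:
  assumes m: "content m"
  shows "m (cyl a) = (\<Sum>b\<in>UNIV. real (count_list ((\<phi> ^^ n) [b]) a) * (desubst ^^ n) m (cyl b))"
proof (induction n)
  case 0
  have "(\<Sum>b\<in>UNIV. real (count_list ((\<phi> ^^ 0) [b]) a) * (desubst ^^ 0) m (cyl b)) =
      (\<Sum>b\<in>UNIV. if b = a then m (cyl b) else 0)"
    by (intro sum.cong) auto
  then show ?case by simp
next
  case (Suc n)
  let ?m = "(desubst ^^ n) m"
  have "m (cyl a) = (\<Sum>c\<in>UNIV. real (count_list ((\<phi> ^^ n) [c]) a) *
      (\<Sum>b\<in>UNIV. real (count_list (\<phi> [b]) c) * desubst ?m (cyl b)))"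
    unfolding Suc by (intro sum.cong refl arg_cong2[of _ _ _ _ "(*)"] content_letter
        desubst_pow_content m)
  also have "\<dots> = (\<Sum>b\<in>UNIV. (\<Sum>c\<in>UNIV. real (count_list (\<phi> [b]) c) *
      real (count_list ((\<phi> ^^ n) [c]) a)) * desubst ?m (cyl b))"
    unfolding sum_distrib_left sum_distrib_right
    by (subst sum.swap) (intro sum.cong refl; simp add: mult_ac)
  also have "\<dots> = (\<Sum>b\<in>UNIV. real (count_list ((\<phi> ^^ n) (\<phi> [b])) a) * desubst ?m (cyl b))"
    unfolding count_list_morphism[OF morphism_funpow[OF hom], of n "\<phi> [_]"] by simp
  finally show ?case by (simp add: funpow_swap1)
qed

text \<open>All entries of M^N are at least 1, so each letter carries at least the whole mass of the
  N-th desubstitution, which is positive.\<close>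

lemma content_cyl_pos:
  assumes m: "content m" and "0 < m L"
  shows "0 < m (cyl a)"
proof -
  obtain N where N: "0 < N" "\<forall>a b. a \<in> set ((\<phi> ^^ N) [b])" by (rule primitive_power)
  let ?m = "(desubst ^^ N) m"
  have m': "content ?m" "0 < ?m L"
    using desubst_pow_content[OF m] desubst_pow_L_pos[OF assms] by auto
  have "?m L = (\<Sum>b\<in>UNIV. ?m (cyl b))" by (rule content_total[OF m'(1)])
  also have "\<dots> \<le> m (cyl a)"
    unfolding content_letter_pow[OF m, of a N]
  proof (rule sum_mono)
    fix b
    have "count_list ((\<phi> ^^ N) [b]) a \<noteq> 0" using N(2) by (simp add: count_list_0_iff)
    then have "1 \<le> real (count_list ((\<phi> ^^ N) [b]) a)" by simp
    then show "?m (cyl b) \<le> real (count_list ((\<phi> ^^ N) [b]) a) * ?m (cyl b)"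
      using content_nonneg[OF m'(1) cyl_sets, of b] by (simp add: mult_le_cancel_right1)
  qed
  finally show ?thesis using m'(2) by simp
qed

lemma desubst_proportional:
  assumes m: "content m" and "0 < m L"
  shows "\<exists>\<kappa>. \<forall>a. desubst m (cyl a) = \<kappa> * m (cyl a)"
proof -
  obtain N where N: "0 < N" "\<forall>a b. a \<in> set ((\<phi> ^^ N) [b])" by (rule primitive_power)
  define P where "P a b = real (count_list ((\<phi> ^^ N) [b]) a)" for a b
  \<comment> \<open>Only every N-th iterate is kept, so that consecutive vectors are linked by the
    positive matrix M^N.\<close>
  define V where "V n k a = (desubst ^^ (N * k)) n (cyl a)" for n k a
  have rec: "V n k a = (\<Sum>b\<in>UNIV. P a b * V n (Suc k) b)" if "content n" for n k a
    using content_letter_pow[OF desubst_pow_content[OF that], of "N * k" a N]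
    by (simp add: V_def P_def funpow_add)
  have nonneg: "0 \<le> V n k a" if "content n" for n k a
    unfolding V_def by (intro content_nonneg desubst_pow_content that cyl_sets)
  have pos: "0 < sum (V n k) UNIV" if "content n" "0 < n L" for n k
    using content_total[OF desubst_pow_content[OF that(1)], of "N * k"]
      desubst_pow_L_pos[OF that, of "N * k"] by (simp add: V_def[abs_def])
  have "\<exists>\<kappa>. \<forall>a. V (desubst m) 0 a = \<kappa> * V m 0 a"
  proof (rule positive_matrix_orbits_proportional)
    show "0 < P a b" for a b
      using N(2) by (simp add: P_def) (metis count_list_0_iff gr0I)
    have m': "content (desubst m)" "0 < desubst m L"
      using desubst_content[OF m] desubst_L_pos[OF assms] by auto
    note rec[OF m'(1)] nonneg[OF m'(1)] pos[OF m'] rec[OF m] nonneg[OF m] pos[OF assms]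
    then show "V (desubst m) k a = (\<Sum>b\<in>UNIV. P a b * V (desubst m) (Suc k) b)"
      "0 \<le> V (desubst m) k a" "0 < sum (V (desubst m) k) UNIV"
      "V m k a = (\<Sum>b\<in>UNIV. P a b * V m (Suc k) b)" "0 \<le> V m k a" "0 < sum (V m k) UNIV"
      for k a
      by -
  qed
  then show ?thesis by (simp add: V_def)
qed

lemma desubst_scaling:
  assumes m: "content m" and "0 < m L"
  obtains \<kappa> where "0 < \<kappa>" "\<kappa> < 1" "\<forall>k a. (desubst ^^ k) m (cyl a) = \<kappa> ^ k * m (cyl a)"
proof -
  obtain \<kappa> where \<kappa>: "\<And>a. desubst m (cyl a) = \<kappa> * m (cyl a)"
    using desubst_proportional[OF assms] by blast
  have pos: "0 < (desubst ^^ k) m (cyl a)" for k a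
    by (rule content_cyl_pos[OF desubst_pow_content[OF m] desubst_pow_L_pos[OF assms]])
  have step: "desubst ((desubst ^^ k) m) (cyl a) = \<kappa> * (desubst ^^ k) m (cyl a)" for k a
  proof (induction k arbitrary: a)
    case 0
    then show ?case by (simp add: \<kappa>)
  next
    case (Suc k)
    let ?n = "(desubst ^^ k) m"
    have n: "content ?n" "content (desubst ?n)" "0 < desubst ?n L"
      using desubst_pow_content[OF m, of k] desubst_content
        desubst_L_pos[OF desubst_pow_content[OF m] desubst_pow_L_pos[OF assms], of k] by auto
    obtain \<kappa>' where \<kappa>': "\<And>a. desubst (desubst ?n) (cyl a) = \<kappa>' * desubst ?n (cyl a)"
      using desubst_proportional[OF n(2,3)] by blast
    \<comment> \<open>A priori each step has its own ratio. Applying M to v_(k+2) = \<kappa>'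
      v_(k+1) gives v_(k+1) = \<kappa>' v_k, which forces \<kappa>' = \<kappa>.\<close>
    have "desubst ?n (cyl a) =
        (\<Sum>b\<in>UNIV. real (count_list (\<phi> [b]) a) * desubst (desubst ?n) (cyl b))"
      by (rule content_letter[OF n(2)])
    also have "\<dots> = \<kappa>' * (\<Sum>b\<in>UNIV. real (count_list (\<phi> [b]) a) * desubst ?n (cyl b))"
      unfolding \<kappa>' sum_distrib_left by (intro sum.cong refl) simp
    also have "\<dots> = \<kappa>' * ?n (cyl a)" by (simp only: content_letter[OF n(1), of a])
    finally have "\<kappa> * ?n (cyl a) = \<kappa>' * ?n (cyl a)" using Suc by simp
    then have "\<kappa>' = \<kappa>" using pos[of k a] by simp
    then show ?case using \<kappa>' by simp
  qed
  have pow: "(desubst ^^ k) m (cyl a) = \<kappa> ^ k * m (cyl a)" for k a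
    by (induction k) (simp_all add: step)
  have cyl_pos: "0 < m (cyl a)" for a using pos[of 0 a] by simp
  have "0 < \<kappa>"
    using pos[of 1] cyl_pos \<kappa> by (simp add: zero_less_mult_iff) (meson less_asym)
  \<comment> \<open>The total mass equals \<kappa> times the letter masses weighted by the image
    lengths. If \<kappa> were at least 1, this would exceed the total mass, as some image is longer
    than 1 and every letter has positive mass.\<close>
  moreover have "\<kappa> < 1"
  proof (rule ccontr)
    assume "\<not> \<kappa> < 1"
    obtain a where a: "1 < length (\<phi> [a])" using long_image_letter by blast
    have le: "m (cyl b) \<le> real (length (\<phi> [b])) * desubst m (cyl b)" for b
    proof -
      have "1 * m (cyl b) \<le> (real (length (\<phi> [b])) * \<kappa>) * m (cyl b)"
        using \<open>\<not> \<kappa> < 1\<close> Suc_leI[OF nonerasing[of b]] cyl_pos[of b]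
        by (intro mult_right_mono mult_ge1_I) auto
      then show ?thesis by (simp add: \<kappa> mult.assoc)
    qed
    have "m (cyl a) < (real (length (\<phi> [a])) * \<kappa>) * m (cyl a)"
    proof -
      have "1 * 1 < real (length (\<phi> [a])) * \<kappa>"
        using a \<open>\<not> \<kappa> < 1\<close> by (intro mult_less_le_imp_less) auto
      then show ?thesis using cyl_pos[of a] by simp
    qed
    then have less: "m (cyl a) < real (length (\<phi> [a])) * desubst m (cyl a)"
      by (simp add: \<kappa> mult.assoc)
    have "m L < m L"
      using content_total[OF m] content_total_desubst[OF m] le less
      by (metis (no_types, lifting) UNIV_I finite sum_strict_mono_ex1)
    then show False by simp
  qed
  ultimately show ?thesis using pow that by blast
qed

lemma desubst_pow_L:
  assumes "content m" "\<forall>k a. (desubst ^^ k) m (cyl a) = \<kappa> ^ k * m (cyl a)"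
  shows "(desubst ^^ k) m L = \<kappa> ^ k * m L"
  using content_total[OF assms(1)] content_total[OF desubst_pow_content[OF assms(1)], of k] assms(2)
  by (simp add: sum_distrib_left)

section \<open>Masses of initial segments and of points\<close>

definition below :: "(nat \<Rightarrow> 'a) \<Rightarrow> (nat \<Rightarrow> 'a) set" where
  "below u = {v \<in> L. lex_le v u}"

lemma below_sets: "below u \<in> sets \<B>"
  unfolding below_def by (rule down_closed_sets) (auto simp: lex_le_def intro: less_fun_trans)

lemma content_below:
  assumes "content m" "u \<in> L"
  shows "m (below u) = (\<Sum>a\<in>{..<u 0}. m (cyl a)) + m (below u \<inter> cyl (u 0))"
proof -
  have "below u = (\<Union>a\<in>{..<u 0}. cyl a) \<union> (below u \<inter> cyl (u 0))"
  proof (intro equalityI subsetI)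
    fix y assume "y \<in> below u"
    then show "y \<in> (\<Union>a\<in>{..<u 0}. cyl a) \<union> (below u \<inter> cyl (u 0))"
      using lex_le_first[of y u] by (auto simp: below_def cyl_def)
  qed (auto simp: below_def cyl_def intro: less_imp_lex_le first_less_imp_less)
  moreover have "(\<Union>a\<in>{..<u 0}. cyl a) \<inter> (below u \<inter> cyl (u 0)) = {}"
    by (auto simp: cyl_def)
  ultimately have "m (below u) = m (\<Union>a\<in>{..<u 0}. cyl a) + m (below u \<inter> cyl (u 0))"
    using content_Un[OF assms(1), of "\<Union>a\<in>{..<u 0}. cyl a" "below u \<inter> cyl (u 0)"]
      below_sets cyl_sets by (simp add: sets.finite_UN sets.Int)
  also have "m (\<Union>a\<in>{..<u 0}. cyl a) = (\<Sum>a\<in>{..<u 0}. m (cyl a))"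
    using assms(1) cyl_sets by (intro content_UN) (auto simp: disjoint_family_on_def cyl_def)
  finally show ?thesis .
qed

text \<open>By \<open>F_le_iff\<close> the segment consists of all levels of smaller type and of the
  part of the level (u 0, p) lying over the words up to \<open>u\<close>.\<close>

lemma content_below_F:
  assumes "content m" "u \<in> L" "p < length (\<phi> [u 0])"
  shows "m (below (F p u)) = (\<Sum>t | t \<in> types \<phi> \<and> (t, (u 0, p)) \<in> r. desubst m (cyl (fst t))) +
    desubst m (below u \<inter> cyl (u 0))"
proof -
  let ?t = "(u 0, p)"
  let ?T = "{t. t \<in> types \<phi> \<and> (t, ?t) \<in> r}"
  define A where "A t = (if t = ?t then below u \<inter> cyl (u 0) else cyl (fst t))" for t
  have "below (F p u) = (\<Union>t\<in>insert ?t ?T. F (snd t) ` A t)"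
  proof safe
    fix y assume "y \<in> below (F p u)"
    then have y: "y \<in> L" "lex_le y (F p u)" by (auto simp: below_def)
    obtain v q where v: "v \<in> L" "q < length (\<phi> [v 0])" "y = F q v" using decompose[OF y(1)] .
    have "((v 0, q), ?t) \<in> r \<or> v 0 = u 0 \<and> q = p \<and> lex_le v u"
      using y(2) F_le_iff[OF v(1,2) assms(2,3)] v(3) by simp
    then have "(v 0, q) \<in> insert ?t ?T" "v \<in> A (v 0, q)"
      using v r_irrefl by (auto simp: A_def types_iff below_def cyl_def)
    then show "y \<in> (\<Union>t\<in>insert ?t ?T. F (snd t) ` A t)" using v(3) by force
  next
    fix v assume "v \<in> A ?t"
    then show "F (snd ?t) v \<in> below (F p u)"
      using assms F_le_iff[of v p u p] by (auto simp: A_def below_def cyl_def F_in_L)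
  next
    fix c q v assume "(c, q) \<in> types \<phi>" "((c, q), ?t) \<in> r" "v \<in> A (c, q)"
    then show "F (snd (c, q)) v \<in> below (F p u)"
      using assms F_le_iff[of v q u p] r_irrefl
      by (auto simp: A_def below_def cyl_def F_in_L types_iff split: if_splits)
  qed
  then have "m (below (F p u)) = m (\<Union>t\<in>insert ?t ?T. F (snd t) ` A t)" by simp
  also have "\<dots> = (\<Sum>t\<in>insert ?t ?T. desubst m (A t))"
  proof (rule content_tower[OF assms(1)])
    show "insert ?t ?T \<subseteq> types \<phi>" using assms by (auto simp: types_iff)
    show "A t \<in> sets \<B>" for t using below_sets cyl_sets by (auto simp: A_def)
    show "A t \<subseteq> cyl (fst t)" for t by (auto simp: A_def)
  qed
  also have "\<dots> = desubst m (A ?t) + (\<Sum>t\<in>?T. desubst m (A t))"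
    using finite_types r_irrefl by (intro sum.insert) auto
  also have "(\<Sum>t\<in>?T. desubst m (A t)) = (\<Sum>t\<in>?T. desubst m (cyl (fst t)))"
    using r_irrefl by (intro sum.cong) (auto simp: A_def)
  finally show ?thesis by (simp add: A_def)
qed

text \<open>
  The defect of the claimed scaling at \<open>\<sigma>\<^sup>p(\<phi>(u))\<close> equals the defect at \<open>u\<close> for the next
  desubstituted content; so it is bounded by total masses that decay like \<open>\<kappa>\<^sup>k\<close>.
\<close>

lemma desubst_below:
  assumes m: "content m" and \<kappa>: "0 < \<kappa>" "\<kappa> < 1"
    "\<forall>k a. (desubst ^^ k) m (cyl a) = \<kappa> ^ k * m (cyl a)" and "u \<in> L"
  shows "desubst m (below u) = \<kappa> * m (below u)"
proof -
  let ?n = "\<lambda>k. (desubst ^^ k) m"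
  have n: "content (?n k)" for k by (rule desubst_pow_content[OF m])
  define d where "d k u = ?n (Suc k) (below u) - \<kappa> * ?n k (below u)" for k u
  have step: "d k (F p u) = d (Suc k) u" if u: "u \<in> L" "p < length (\<phi> [u 0])" for k p u
  proof -
    let ?T = "{t. t \<in> types \<phi> \<and> (t, (u 0, p)) \<in> r}"
    have 1: "?n k (below (F p u)) = (\<Sum>t\<in>?T. \<kappa> ^ Suc k * m (cyl (fst t))) +
        (?n (Suc k) (below u) - (\<Sum>a\<in>{..<u 0}. \<kappa> ^ Suc k * m (cyl a)))" for k
    proof -
      have "?n k (below (F p u)) = (\<Sum>t\<in>?T. ?n (Suc k) (cyl (fst t))) +
          ?n (Suc k) (below u \<inter> cyl (u 0))"
        using content_below_F[OF n u] by simp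
      moreover have "?n (Suc k) (below u) =
          (\<Sum>a\<in>{..<u 0}. ?n (Suc k) (cyl a)) + ?n (Suc k) (below u \<inter> cyl (u 0))"
        by (rule content_below[OF n u(1)])
      ultimately show ?thesis unfolding \<kappa>(3)[rule_format] by simp
    qed
    \<comment> \<open>The sums over whole cylinders scale exactly by \<kappa>, so they cancel in the
      defect and only the two masses of \<open>below u\<close> remain.\<close>
    have 2: "(\<Sum>i\<in>I. \<kappa> ^ Suc (Suc k) * f i) = \<kappa> * (\<Sum>i\<in>I. \<kappa> ^ Suc k * f i)"
      for I and f :: "'c \<Rightarrow> real"
      unfolding sum_distrib_left by (intro sum.cong) auto
    show ?thesis unfolding d_def 1 2 by (simp add: algebra_simps)
  qed
  have mL: "0 \<le> m L" by (rule content_nonneg[OF m L_sets])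
  have bound: "\<bar>d k u\<bar> \<le> \<kappa> ^ (Suc k + j) * m L" if "u \<in> L" for j k u
    using that
  proof (induction j arbitrary: k u)
    case 0
    \<comment> \<open>Both terms of the defect lie between 0 and \<kappa>^(k+1) \<open>m L\<close>,
      hence so does the modulus of their difference.\<close>
    have b: "0 \<le> ?n k (below u)" "?n k (below u) \<le> \<kappa> ^ k * m L" for k
      using content_nonneg[OF n below_sets] content_mono[OF n below_sets L_sets, of u k]
        desubst_pow_L[OF m \<kappa>(3)] by (auto simp: below_def)
    have "0 \<le> \<kappa> * ?n k (below u)" "\<kappa> * ?n k (below u) \<le> \<kappa> * (\<kappa> ^ k * m L)"
      using b[of k] \<kappa>(1) by (auto intro: mult_left_mono)
    then show ?case using b[of "Suc k"] unfolding d_def by (simp add: mult.assoc)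
  next
    case (Suc j)
    obtain v q where v: "v \<in> L" "q < length (\<phi> [v 0])" "u = F q v" using decompose[OF Suc.prems] .
    then show ?case using Suc.IH[OF v(1), of "Suc k"] step[OF v(1,2), of k] by simp
  qed
  have "(\<lambda>j. \<kappa> ^ j * (\<kappa> * m L)) \<longlonglongrightarrow> 0 * (\<kappa> * m L)"
    using \<kappa> by (intro tendsto_mult_right LIMSEQ_realpow_zero) auto
  then have "\<bar>d 0 u\<bar> \<le> 0"
    using bound[OF \<open>u \<in> L\<close>, of 0]
    by (intro LIMSEQ_le_const[where X = "\<lambda>j. \<kappa> ^ j * (\<kappa> * m L)"]) (auto simp: mult_ac)
  then show ?thesis by (simp add: d_def)
qed

text \<open>Desubstituting a point gives a point of the same mass for the desubstituted content,
  whose total mass tends to 0 under iteration.\<close>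

lemma content_singleton:
  assumes m: "content m" and \<kappa>: "0 < \<kappa>" "\<kappa> < 1"
    "\<forall>k a. (desubst ^^ k) m (cyl a) = \<kappa> ^ k * m (cyl a)" and "u \<in> L"
  shows "m {u} = 0"
proof -
  have bound: "n {u} \<le> (desubst ^^ k) n L" if "content n" "u \<in> L" for k n u
    using that
  proof (induction k arbitrary: n u)
    case 0
    then show ?case using content_mono[OF 0(1) singleton_sets L_sets] by simp
  next
    case (Suc k)
    obtain v q where v: "v \<in> L" "q < length (\<phi> [v 0])" "u = F q v" using decompose[OF Suc.prems(2)] .
    have "n {u} = desubst n {v}"
      using content_F[OF Suc.prems(1) singleton_sets, of v "v 0" q] v by (simp add: cyl_def)
    also have "\<dots> \<le> (desubst ^^ k) (desubst n) L"
      by (rule Suc.IH[OF desubst_content[OF Suc.prems(1)] v(1)])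
    finally show ?case by (simp add: funpow_swap1)
  qed
  have "(\<lambda>k. \<kappa> ^ k * m L) \<longlonglongrightarrow> 0 * m L"
    using \<kappa> by (intro tendsto_mult_right LIMSEQ_realpow_zero) auto
  then have "m {u} \<le> 0"
    using bound[OF m \<open>u \<in> L\<close>] unfolding desubst_pow_L[OF m \<kappa>(3)]
    by (intro LIMSEQ_le_const[where X = "\<lambda>k. \<kappa> ^ k * m L"]) auto
  then show ?thesis using content_nonneg[OF m singleton_sets[OF \<open>u \<in> L\<close>]] by simp
qed

section \<open>Positivity of cylinders\<close>

lemma \<Phi>_pow_prefix:
  "map ((\<Phi> ^^ k) v) [0..<length ((\<phi> ^^ k) (map v [0..<n]))] = (\<phi> ^^ k) (map v [0..<n])"
proof (induction k)
  case 0
  show ?case by simp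
next
  case (Suc k)
  let ?w = "(\<Phi> ^^ k) v" and ?l = "(\<phi> ^^ k) (map v [0..<n])"
  have "\<Phi> ?w i = \<phi> ?l ! i" if "i < length (\<phi> ?l)" for i
    using \<Phi>_nth[of i ?w "length ?l"] that unfolding Suc by simp
  then show ?case by (intro nth_equalityI) auto
qed

text \<open>Each letter has at least two distinct letters in its image under a primitive power, so
  that power at least doubles lengths.\<close>

lemma \<phi>_pow_length_unbounded: "\<exists>k. n \<le> length ((\<phi> ^^ k) [a])"
proof -
  obtain N where N: "0 < N" "\<forall>a b. a \<in> set ((\<phi> ^^ N) [b])" by (rule primitive_power)
  have two: "2 \<le> length ((\<phi> ^^ N) [b])" for b
  proof -
    obtain c d :: 'a where "c \<noteq> d" using two_letters by blast
    then have "card {c, d} = 2" by simp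
    moreover have "{c, d} \<subseteq> set ((\<phi> ^^ N) [b])" using N by auto
    ultimately have "2 \<le> card (set ((\<phi> ^^ N) [b]))" by (metis card_mono List.finite_set)
    then show ?thesis using card_length order_trans by blast
  qed
  have double: "2 * length l \<le> length ((\<phi> ^^ N) l)" for l
  proof (induction l)
    case (Cons b l)
    then show ?case
      using morphism_append[OF morphism_funpow[OF hom], of N "[b]" l] two[of b] by simp
  qed simp
  have "k < length ((\<phi> ^^ (N * k)) [a])" for k
  proof (induction k)
    case (Suc k)
    have "length ((\<phi> ^^ (N * Suc k)) [a]) = length ((\<phi> ^^ N) ((\<phi> ^^ (N * k)) [a]))"
      by (simp add: funpow_add)
    then show ?case using double[of "(\<phi> ^^ (N * k)) [a]"] Suc by linarith
  qed simp
  then show ?thesis by (intro exI[of _ "N * n"]) (simp add: less_imp_le)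
qed

lemma desubst_pow: "(desubst ^^ k) m A = m ((\<Phi> ^^ k) ` A)"
  by (induction k arbitrary: A) (simp_all add: desubst_def image_image funpow_swap1[of \<Phi>])

lemma content_shift_pow:
  assumes "content m" "A \<in> sets \<B>"
  shows "{y \<in> L. (shift ^^ j) y \<in> A} \<in> sets \<B> \<and> m {y \<in> L. (shift ^^ j) y \<in> A} = m A"
proof (induction j)
  case 0
  have "{y \<in> L. (shift ^^ 0) y \<in> A} = A" using sets_subset_L[OF assms(2)] by auto
  then show ?case using assms(2) by simp
next
  case (Suc j)
  let ?A = "{y \<in> L. (shift ^^ j) y \<in> A}"
  have "{y \<in> L. (shift ^^ Suc j) y \<in> A} = {y \<in> L. shift y \<in> ?A}"
    by (auto simp: funpow_swap1 shift_in_L)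
  then show ?case
    using Suc shift_preimage_sets[of ?A] content_shift[OF assms(1), of ?A] by simp
qed

text \<open>
  A word occurring at position \<open>j\<close> of the fixed point occurs at position \<open>j\<close> in the image under a
  high power of \<open>\<phi>\<close> of every word starting with the letter \<open>x 0\<close>.
\<close>

lemma content_prefix_pos:
  assumes m: "content m" "0 < m L" and "u \<in> L"
  shows "0 < m (prefix_set (map u [0..<n]))"
proof -
  obtain j where j: "\<forall>i<n. u i = x (j + i)" using iffD1[OF mem_L \<open>u \<in> L\<close>] by blast
  obtain k where k: "j + n \<le> length ((\<phi> ^^ k) [x 0])" using \<phi>_pow_length_unbounded by blast
  let ?P = "prefix_set (map u [0..<n])"
  let ?Q = "{y \<in> L. (shift ^^ j) y \<in> ?P}"
  have xk: "(\<Phi> ^^ k) x = x" by (induction k) (simp_all add: fixed_point)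
  have \<Phi>L: "(\<Phi> ^^ k) v \<in> L" if "v \<in> L" for v
    using that by (induction k) (auto intro: \<Phi>_in_L)
  have agree: "(\<Phi> ^^ k) v i = x i" if "v 0 = x 0" "i < j + n" for v i
  proof -
    have "map ((\<Phi> ^^ k) v) [0..<length ((\<phi> ^^ k) [x 0])] = map x [0..<length ((\<phi> ^^ k) [x 0])]"
      using \<Phi>_pow_prefix[of k v 1] \<Phi>_pow_prefix[of k x 1] that(1) xk by simp
    then show ?thesis using that(2) k by (simp add: map_eq_conv)
  qed
  have "0 < (desubst ^^ k) m (cyl (x 0))"
    by (rule content_cyl_pos[OF desubst_pow_content[OF m(1)] desubst_pow_L_pos[OF m]])
  also have "\<dots> = m ((\<Phi> ^^ k) ` cyl (x 0))" by (rule desubst_pow)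
  also have "\<dots> \<le> m ?Q"
  proof (rule content_mono[OF m(1)])
    have "(\<Phi> ^^ k) ` A \<in> sets \<B>" if "A \<in> sets \<B>" for A
      using that
    proof (induction k)
      case (Suc k)
      have "(\<Phi> ^^ Suc k) ` A = \<Phi> ` (\<Phi> ^^ k) ` A" by (simp add: image_image)
      then show ?case using \<Phi>_image_sets[OF Suc.IH[OF Suc.prems]] by (simp only:)
    qed simp
    then show "(\<Phi> ^^ k) ` cyl (x 0) \<in> sets \<B>" using cyl_sets by blast
    show "?Q \<in> sets \<B>" using content_shift_pow[OF m(1) prefix_set_sets] by blast
    show "(\<Phi> ^^ k) ` cyl (x 0) \<subseteq> ?Q"
      using j agree \<Phi>L by (auto simp: cyl_def mem_prefix_set shift_funpow shift_funpow_in_L[unfolded shift_funpow])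
  qed
  also have "\<dots> = m ?P" using content_shift_pow[OF m(1) prefix_set_sets] by blast
  finally show ?thesis .
qed

end

section \<open>The extended distribution function\<close>

locale measured_separable_substitution = separable_substitution \<phi> x L r
  for \<phi> :: "'a::{finite,linorder} list \<Rightarrow> 'a list" and x L r +
  fixes \<mu> :: "(nat \<Rightarrow> 'a) measure"
  assumes invariant: "invariant_prob L \<mu>"
begin

abbreviation m :: "(nat \<Rightarrow> 'a) set \<Rightarrow> real" where "m \<equiv> measure \<mu>"

abbreviation Z :: "real set" where "Z \<equiv> doubled_points L \<mu>"

abbreviation R :: "(nat \<Rightarrow> 'a) \<Rightarrow> real" where "R \<equiv> nu_real L \<mu>"

abbreviation \<nu> :: "(nat \<Rightarrow> 'a) \<Rightarrow> xreal" where "\<nu> \<equiv> nu L \<mu>"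

lemma sets_\<mu>: "sets \<mu> = sets \<B>"
  using invariant by (simp add: invariant_prob_def)

lemma space_\<mu>: "space \<mu> = L"
  using sets_eq_imp_space_eq[OF sets_\<mu>] by (simp only: space_\<B>)

lemma content_\<mu>: "content m"
  unfolding content_def
proof (intro conjI ballI impI)
  interpret prob_space \<mu> using invariant by (simp add: invariant_prob_def)
  show "m (A \<union> B) = m A + m B" if "A \<in> sets \<B>" "B \<in> sets \<B>" "A \<inter> B = {}" for A B
    using that unfolding sets_\<mu>[symmetric] by (rule finite_measure_Union)
  fix A assume "A \<in> sets \<B>"
  then have A: "A \<in> sets \<mu>" by (simp only: sets_\<mu>)
  have "shift \<in> measurable \<mu> \<mu>" "distr \<mu> \<mu> shift = \<mu>"
    using invariant by (auto simp: invariant_prob_def)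
  then have "m A = m (shift -` A \<inter> space \<mu>)" using measure_distr[OF _ A] by metis
  also have "shift -` A \<inter> space \<mu> = {y \<in> L. shift y \<in> A}" by (auto simp: space_\<mu>)
  finally show "m {y \<in> L. shift y \<in> A} = m A" by simp
qed simp

lemma m_L: "m L = 1"
  using invariant prob_space.prob_space[of \<mu>] by (simp add: invariant_prob_def space_\<mu>)

lemma m_L_pos: "0 < m L"
  by (simp add: m_L)

definition \<kappa> :: real where
  "\<kappa> = (SOME \<kappa>. 0 < \<kappa> \<and> \<kappa> < 1 \<and> (\<forall>k a. (desubst ^^ k) m (cyl a) = \<kappa> ^ k * m (cyl a)))"

lemma \<kappa>: "0 < \<kappa>" "\<kappa> < 1" "\<forall>k a. (desubst ^^ k) m (cyl a) = \<kappa> ^ k * m (cyl a)"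
proof -
  have "\<exists>\<kappa>. 0 < \<kappa> \<and> \<kappa> < 1 \<and> (\<forall>k a. (desubst ^^ k) m (cyl a) = \<kappa> ^ k * m (cyl a))"
    by (rule desubst_scaling[OF content_\<mu> m_L_pos]) blast
  from someI_ex[OF this, folded \<kappa>_def]
  show "0 < \<kappa>" "\<kappa> < 1" "\<forall>k a. (desubst ^^ k) m (cyl a) = \<kappa> ^ k * m (cyl a)" by auto
qed

lemma desubst_cyl: "desubst m (cyl a) = \<kappa> * m (cyl a)"
  using \<kappa>(3)[rule_format, of 1] by simp

lemma cyl_pos: "0 < m (cyl a)"
  by (rule content_cyl_pos[OF content_\<mu> m_L_pos])

text \<open>The letter measures satisfy v = M(\<kappa> v), so they form a positive eigenvector for 1
  / \<kappa>.\<close>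

lemma perron_frobenius_eq: "perron_frobenius (incidence_matrix \<phi>) = 1 / \<kappa>"
proof (rule perron_frobenius_eqI)
  show "incidence_matrix \<phi> $ i $ j = complex_of_real (real (count_list (\<phi> [j]) i))" for i j
    by (simp add: incidence_matrix_def)
  show "(\<Sum>j\<in>UNIV. real (count_list (\<phi> [j]) i) * m (cyl j)) = 1 / \<kappa> * m (cyl i)" for i
  proof -
    have "m (cyl i) = \<kappa> * (\<Sum>j\<in>UNIV. real (count_list (\<phi> [j]) i) * m (cyl j))"
      unfolding content_letter[OF content_\<mu>, of i] desubst_cyl sum_distrib_left
      by (intro sum.cong) auto
    then show ?thesis using \<kappa>(1) by simp
  qed
qed (auto intro: cyl_pos)

lemma letter_measure_eq: "letter_measure L \<mu> a = m (cyl a)"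
  by (simp add: letter_measure_def cyl_def)

lemma type_length_eq: "type_length \<phi> L \<mu> t = desubst m (cyl (fst t))"
  by (simp add: type_length_def case_prod_unfold letter_measure_eq perron_frobenius_eq desubst_cyl)

section \<open>The real distribution function\<close>

lemma atomless: "u \<in> L \<Longrightarrow> m {u} = 0"
  by (rule content_singleton[OF content_\<mu> \<kappa>])

lemma nbhd_pos: "u \<in> L \<Longrightarrow> 0 < m (prefix_set (map u [0..<n]))"
  by (rule content_prefix_pos[OF content_\<mu> m_L_pos])

text \<open>The least word enters \<open>nu_real\<close> by a definite description, which denotes it
  only because the closed set L has a unique least element; the lower bound then holds for all words
  of L.\<close>

lemma R_eq: "R v = m (below v)"
proof -
  have "L \<noteq> {}" using x_in_L by blast
  then obtain w where w: "w \<in> L" "\<And>y. y \<in> L \<Longrightarrow> lex_le w y"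
    using closed_has_least[of L] L_closed by metis
  have "(THE w. w \<in> L \<and> (\<forall>x\<in>L. lex_le w x)) = w"
    using w lex_le_antisym by (intro the_equality) blast+
  moreover have "{x \<in> L. lex_le w x \<and> lex_le x v} = below v" using w by (auto simp: below_def)
  ultimately show ?thesis by (simp add: nu_real_def)
qed

text \<open>On the words with a fixed first letter, passing from \<open>u\<close> to
  \<open>F p u\<close> is affine on the values, with slope \<kappa>. This is the claim for one
  branch, up to signs.\<close>

lemma R_F:
  assumes "u \<in> L" "p < length (\<phi> [u 0])"
  shows "R (F p u) = (\<Sum>t | t \<in> types \<phi> \<and> (t, (u 0, p)) \<in> r. type_length \<phi> L \<mu> t) +
    \<kappa> * (R u - (\<Sum>b\<in>{..<u 0}. letter_measure L \<mu> b))"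
proof -
  have "desubst m (below u \<inter> cyl (u 0)) = \<kappa> * m (below u) - (\<Sum>b\<in>{..<u 0}. \<kappa> * m (cyl b))"
    using content_below[OF desubst_content[OF content_\<mu>] assms(1)]
      desubst_below[OF content_\<mu> \<kappa> assms(1)] by (simp add: desubst_cyl)
  then show ?thesis
    using content_below_F[OF content_\<mu> assms]
    by (simp add: R_eq type_length_eq letter_measure_eq sum_distrib_left right_diff_distrib)
qed

lemma R_split:
  assumes "u \<in> L" "v \<in> L" "less_fun u v"
  shows "R v = R u + m {y \<in> L. less_fun u y \<and> lex_le y v}" "{y \<in> L. less_fun u y \<and> lex_le y v} \<in> sets \<B>"
proof -
  have eq: "{y \<in> L. less_fun u y \<and> lex_le y v} = below v - below u"
    by (auto simp: below_def not_lex_le[symmetric])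
  then show "{y \<in> L. less_fun u y \<and> lex_le y v} \<in> sets \<B>" using below_sets by auto
  have "below v = below u \<union> (below v - below u)"
    using assms(3) by (auto simp: below_def lex_le_def intro: less_fun_trans)
  then show "R v = R u + m {y \<in> L. less_fun u y \<and> lex_le y v}"
    unfolding R_eq eq using content_Un[OF content_\<mu> below_sets, of "below v - below u" u] below_sets
    by (metis Diff_disjoint sets.Diff)
qed

lemma R_mono: "u \<in> L \<Longrightarrow> v \<in> L \<Longrightarrow> less_fun u v \<Longrightarrow> R u \<le> R v"
  using R_split[of u v] content_nonneg[OF content_\<mu>] by simp

lemma R_range: "0 \<le> R v" "R v \<le> 1"
  using content_nonneg[OF content_\<mu> below_sets] content_mono[OF content_\<mu> below_sets L_sets, of v]
  by (auto simp: R_eq m_L[symmetric] below_def)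

lemma R_less_between:
  assumes "u \<in> L" "v \<in> L" "y \<in> L" "less_fun u y" "less_fun y v"
  shows "R u < R v"
proof -
  obtain n where n: "\<forall>z. (\<forall>i<n. z i = y i) \<longrightarrow> less_fun z v"
    using assms(5) by (rule less_fun_open_left)
  obtain k where k: "\<forall>z. (\<forall>i<k. z i = y i) \<longrightarrow> less_fun u z"
    using assms(4) by (rule less_fun_open_right)
  have uv: "less_fun u v" using assms(4,5) by (rule less_fun_trans)
  have "prefix_set (map y [0..<max n k]) \<subseteq> {y \<in> L. less_fun u y \<and> lex_le y v}"
    using n k by (auto simp: mem_prefix_set lex_le_def)
  then have "m (prefix_set (map y [0..<max n k])) \<le> m {y \<in> L. less_fun u y \<and> lex_le y v}"
    by (intro content_mono[OF content_\<mu> prefix_set_sets R_split(2)[OF assms(1,2) uv]])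
  then show ?thesis
    using nbhd_pos[OF assms(3), of "max n k"] R_split(1)[OF assms(1,2) uv] by simp
qed

text \<open>A gap between neighbours has no mass because points are null; conversely a word strictly
  between would bring a cylinder of positive mass.\<close>

lemma consecutive_iff:
  assumes "u \<in> L" "v \<in> L" "less_fun u v"
  shows "consecutive L u v \<longleftrightarrow> R u = R v"
proof
  assume "consecutive L u v"
  then have "{y \<in> L. less_fun u y \<and> lex_le y v} = {v}"
    using assms by (auto simp: consecutive_def lex_le_def)
  then show "R u = R v" using R_split(1)[OF assms] atomless[OF assms(2)] by simp
next
  assume "R u = R v"
  then show "consecutive L u v"
    using R_less_between[OF assms(1,2)] assms by (fastforce simp: consecutive_def)
qed

lemma not_isolated:
  assumes "v \<in> L" "{y \<in> L. \<forall>i<n. y i = v i} = {v}"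
  shows False
proof -
  have "prefix_set (map v [0..<n]) = {v}" using assms(2) by (auto simp: mem_prefix_set)
  then show False using nbhd_pos[OF assms(1), of n] atomless[OF assms(1)] by simp
qed

lemma consecutive_open_left:
  assumes "consecutive L v w"
  obtains n where "\<forall>y\<in>L. (\<forall>i<n. y i = v i) \<longrightarrow> lex_le y v"
proof -
  obtain n where "\<forall>z. (\<forall>i<n. z i = v i) \<longrightarrow> less_fun z w"
    using assms less_fun_open_left unfolding consecutive_def by blast
  then have "\<forall>y\<in>L. (\<forall>i<n. y i = v i) \<longrightarrow> lex_le y v"
    using assms unfolding consecutive_def not_less_fun[symmetric] by blast
  then show ?thesis by (rule that)
qed

lemma consecutive_open_right:
  assumes "consecutive L w v"
  obtains n where "\<forall>y\<in>L. (\<forall>i<n. y i = v i) \<longrightarrow> lex_le v y"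
proof -
  obtain n where "\<forall>z. (\<forall>i<n. z i = v i) \<longrightarrow> less_fun w z"
    using assms less_fun_open_right unfolding consecutive_def by blast
  then have "\<forall>y\<in>L. (\<forall>i<n. y i = v i) \<longrightarrow> lex_le v y"
    using assms unfolding consecutive_def not_less_fun[symmetric] by blast
  then show ?thesis by (rule that)
qed

section \<open>Immediate neighbours and the signs of the values\<close>

definition no_pred :: "(nat \<Rightarrow> 'a) \<Rightarrow> bool" where "no_pred v \<longleftrightarrow> \<not> (\<exists>u. consecutive L u v)"

definition no_succ :: "(nat \<Rightarrow> 'a) \<Rightarrow> bool" where "no_succ v \<longleftrightarrow> \<not> (\<exists>u. consecutive L v u)"

text \<open>A word with neighbours on both sides would be isolated. Hence the cases in the
  definition of \<open>nu\<close> do not compete.\<close>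

lemma pred_imp_no_succ: "consecutive L u v \<Longrightarrow> no_succ v"
proof (rule ccontr)
  assume uv: "consecutive L u v" and "\<not> no_succ v"
  then obtain w where vw: "consecutive L v w" by (auto simp: no_succ_def)
  obtain n where n: "\<forall>y\<in>L. (\<forall>i<n. y i = v i) \<longrightarrow> lex_le v y"
    using uv by (rule consecutive_open_right)
  obtain k where k: "\<forall>y\<in>L. (\<forall>i<k. y i = v i) \<longrightarrow> lex_le y v"
    using vw by (rule consecutive_open_left)
  have "v \<in> L" using uv by (simp add: consecutive_def)
  moreover from this have "{y \<in> L. \<forall>i<max n k. y i = v i} = {v}"
    using n k by (auto intro!: lex_le_antisym)
  ultimately show False by (rule not_isolated)
qed

text \<open>A least word with a successor would be isolated too. So its value is not doubled, as the
  lower endpoint of the first interval requires.\<close>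

lemma least_imp_no_succ: "v \<in> L \<Longrightarrow> \<forall>y\<in>L. lex_le v y \<Longrightarrow> no_succ v"
proof (rule ccontr)
  assume v: "v \<in> L" "\<forall>y\<in>L. lex_le v y" and "\<not> no_succ v"
  then obtain w where vw: "consecutive L v w" by (auto simp: no_succ_def)
  obtain k where k: "\<forall>y\<in>L. (\<forall>i<k. y i = v i) \<longrightarrow> lex_le y v"
    using vw by (rule consecutive_open_left)
  have "{y \<in> L. \<forall>i<k. y i = v i} = {v}"
    using v k by (auto intro!: lex_le_antisym)
  with v(1) show False by (rule not_isolated)
qed

lemma greatest_imp_no_pred: "v \<in> L \<Longrightarrow> \<forall>y\<in>L. lex_le y v \<Longrightarrow> no_pred v"
proof (rule ccontr)
  assume v: "v \<in> L" "\<forall>y\<in>L. lex_le y v" and "\<not> no_pred v"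
  then obtain w where vw: "consecutive L w v" by (auto simp: no_pred_def)
  obtain k where k: "\<forall>y\<in>L. (\<forall>i<k. y i = v i) \<longrightarrow> lex_le v y"
    using vw by (rule consecutive_open_right)
  have "{y \<in> L. \<forall>i<k. y i = v i} = {v}"
    using v k by (auto intro!: lex_le_antisym)
  with v(1) show False by (rule not_isolated)
qed

lemma least_imp_no_pred: "\<forall>y\<in>L. lex_le v y \<Longrightarrow> no_pred v"
  by (auto simp: no_pred_def consecutive_def not_less_fun)

lemma greatest_imp_no_succ: "\<forall>y\<in>L. lex_le y v \<Longrightarrow> no_succ v"
  by (auto simp: no_succ_def consecutive_def not_less_fun)

lemma consecutiveD: "consecutive L u v \<Longrightarrow> u \<in> L \<and> v \<in> L \<and> less_fun u v \<and> R u = R v"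
  using consecutive_iff by (auto simp: consecutive_def)

lemma \<nu>_succ: "consecutive L v w \<Longrightarrow> \<nu> v = Minus (R v) \<and> R v \<in> Z"
  by (auto simp: nu_def doubled_points_def)

lemma \<nu>_pred: "consecutive L u v \<Longrightarrow> \<nu> v = Plus (R v) \<and> R v \<in> Z"
proof -
  assume uv: "consecutive L u v"
  then have "R u \<in> Z" by (auto simp: doubled_points_def)
  then show ?thesis
    using pred_imp_no_succ[OF uv] consecutiveD[OF uv] uv by (auto simp: nu_def no_succ_def)
qed

text \<open>The value could still be doubled on account of another pair s < t. But equal values make
  distinct words consecutive, so \<open>v\<close> would be a neighbour of t if v < t, and of s
  otherwise.\<close>

lemma \<nu>_plain:
  assumes "v \<in> L" "no_pred v" "no_succ v"
  shows "\<nu> v = Plain (R v) \<and> R v \<notin> Z"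
proof -
  have False if Z: "R v \<in> Z"
  proof -
    obtain s t where "R v = R s" and st: "consecutive L s t"
      using Z unfolding doubled_points_def by blast
    then have R: "R v = R s" "R v = R t" "s \<in> L" "t \<in> L" "less_fun s t"
      using consecutiveD[OF st] by auto
    show False
    proof (cases "less_fun v t")
      case True
      then show False using consecutive_iff[OF assms(1) R(4)] R(2) assms(3) by (auto simp: no_succ_def)
    next
      case False
      then have "less_fun s v" using R(5) by (auto simp: not_less_fun intro: less_lex_le_trans)
      then show False
        using consecutive_iff[OF R(3) assms(1)] R(1) assms(2) by (auto simp: no_pred_def)
    qed
  qed
  then show ?thesis using assms(2,3) by (auto simp: nu_def no_pred_def no_succ_def)
qed

lemma \<nu>_strict_mono:
  assumes "u \<in> L" "v \<in> L" "less_fun u v"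
  shows "\<nu> u < \<nu> v"
proof (cases "R u = R v")
  case True
  then have "consecutive L u v" using consecutive_iff assms by blast
  then show ?thesis using \<nu>_succ[of u v] \<nu>_pred[of u v] True by (simp add: less_xreal_def)
next
  case False
  have "real_of (\<nu> v) = R v" for v by (simp add: nu_def)
  then show ?thesis using False R_mono[OF assms] by (simp add: less_xreal_def)
qed

lemma \<nu>_mono: "u \<in> L \<Longrightarrow> v \<in> L \<Longrightarrow> lex_le u v \<Longrightarrow> \<nu> u \<le> \<nu> v"
  using \<nu>_strict_mono[of u v] by (auto simp: lex_le_def)

lemma \<nu>_inj: "u \<in> L \<Longrightarrow> v \<in> L \<Longrightarrow> \<nu> u = \<nu> v \<Longrightarrow> u = v"
  using less_fun_total[of u v] \<nu>_strict_mono[of u v] \<nu>_strict_mono[of v u] by auto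

lemma \<nu>_in_ext_interval:
  assumes "v \<in> L" shows "\<nu> v \<in> ext_interval L \<mu>"
proof -
  consider u where "consecutive L u v" | u where "consecutive L v u" | "no_pred v" "no_succ v"
    by (auto simp: no_pred_def no_succ_def)
  then show ?thesis
    using \<nu>_pred[of _ v] \<nu>_succ[of v] \<nu>_plain[OF assms] R_range[of v]
    by cases (auto simp: ext_interval_def Let_def)
qed

text \<open>The lower end of a letter or type interval is attained at a word that is either least in
  L, hence undoubled, or has a predecessor, hence carries \<open>Plus\<close>;
  \<open>right_copy\<close> covers both.\<close>

lemma \<nu>_right_copy:
  assumes "v \<in> L" "(\<forall>y\<in>L. lex_le v y) \<or> (\<exists>u. consecutive L u v)"
  shows "\<nu> v = right_copy Z (R v)"
  using assms(2)
proof
  assume "\<forall>y\<in>L. lex_le v y"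
  then show ?thesis
    using \<nu>_plain[OF assms(1)] least_imp_no_pred least_imp_no_succ[OF assms(1)]
    by (simp add: right_copy_def)
qed (use \<nu>_pred in \<open>auto simp: right_copy_def\<close>)

lemma \<nu>_left_copy:
  assumes "v \<in> L" "(\<forall>y\<in>L. lex_le y v) \<or> (\<exists>u. consecutive L v u)"
  shows "\<nu> v = left_copy Z (R v)"
  using assms(2)
proof
  assume "\<forall>y\<in>L. lex_le y v"
  then show ?thesis
    using \<nu>_plain[OF assms(1)] greatest_imp_no_succ greatest_imp_no_pred[OF assms(1)]
    by (simp add: left_copy_def)
qed (use \<nu>_succ in \<open>auto simp: left_copy_def\<close>)

subsection \<open>Endpoints of the letter intervals and of the type intervals\<close>

text \<open>Endpoints of the intervals are represented by words, so that comparisons in the extended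
  interval become comparisons in L.\<close>

definition lo :: "'a \<Rightarrow> nat \<Rightarrow> 'a" where
  "lo a = (SOME w. w \<in> cyl a \<and> (\<forall>y\<in>cyl a. lex_le w y))"

definition hi :: "'a \<Rightarrow> nat \<Rightarrow> 'a" where
  "hi a = (SOME w. w \<in> cyl a \<and> (\<forall>y\<in>cyl a. lex_le y w))"

lemma cyl_nonempty: "cyl a \<noteq> {}"
  using cyl_pos[of a] by auto

lemma lo: "lo a \<in> L" "lo a 0 = a" "y \<in> L \<Longrightarrow> y 0 = a \<Longrightarrow> lex_le (lo a) y"
proof -
  have "\<exists>w. w \<in> cyl a \<and> (\<forall>y\<in>cyl a. lex_le w y)"
    by (rule closed_has_least[OF cyl_nonempty cyl_closed]) blast+
  from someI_ex[OF this, folded lo_def]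
  show "lo a \<in> L" "lo a 0 = a" "y \<in> L \<Longrightarrow> y 0 = a \<Longrightarrow> lex_le (lo a) y"
    by (auto simp: cyl_def)
qed

lemma hi: "hi a \<in> L" "hi a 0 = a" "y \<in> L \<Longrightarrow> y 0 = a \<Longrightarrow> lex_le y (hi a)"
proof -
  have "\<exists>w. w \<in> cyl a \<and> (\<forall>y\<in>cyl a. lex_le y w)"
    by (rule closed_has_greatest[OF cyl_nonempty cyl_closed]) blast+
  from someI_ex[OF this, folded hi_def]
  show "hi a \<in> L" "hi a 0 = a" "y \<in> L \<Longrightarrow> y 0 = a \<Longrightarrow> lex_le y (hi a)"
    by (auto simp: cyl_def)
qed

lemma R_lo: "R (lo a) = (\<Sum>b\<in>{..<a}. letter_measure L \<mu> b)"
proof -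
  have "below (lo a) \<inter> cyl a = {lo a}"
    using lo lex_le_antisym by (fastforce simp: below_def cyl_def)
  then show ?thesis
    using content_below[OF content_\<mu> lo(1)[of a]] atomless[OF lo(1)[of a]] lo(2)[of a]
    by (simp add: R_eq letter_measure_eq)
qed

lemma R_hi: "R (hi a) = (\<Sum>b\<in>{..a}. letter_measure L \<mu> b)"
proof -
  have "below (hi a) \<inter> cyl a = cyl a"
    using hi by (auto simp: below_def cyl_def)
  moreover have "{..a} = insert a {..<a}" by auto
  ultimately show ?thesis
    using content_below[OF content_\<mu> hi(1)[of a]] hi(2)[of a]
    by (simp add: R_eq letter_measure_eq)
qed

lemma R_hi_lo: "R (hi a) - R (lo a) = m (cyl a)"
proof -
  have "{..a} = insert a {..<a}" by auto
  then show ?thesis by (simp add: R_hi R_lo letter_measure_eq)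
qed

lemma consecutive_hi_lo:
  assumes "b < a" "\<And>c. c < a \<Longrightarrow> c \<le> b"
  shows "consecutive L (hi b) (lo a)"
  unfolding consecutive_def
proof (intro conjI notI)
  show "less_fun (hi b) (lo a)" by (rule first_less_imp_less) (simp add: lo hi assms(1))
  assume "\<exists>y\<in>L. less_fun (hi b) y \<and> less_fun y (lo a)"
  then obtain y where y: "y \<in> L" "less_fun (hi b) y" "less_fun y (lo a)" by blast
  have "y 0 \<le> a" "b \<le> y 0"
    using lex_le_first[OF less_imp_lex_le[OF y(2)]] lex_le_first[OF less_imp_lex_le[OF y(3)]]
    by (simp_all add: lo hi)
  moreover have "y 0 \<noteq> a" "y 0 \<noteq> b"
    using y lo(3)[of y a] hi(3)[of y b] by (auto simp: not_less_fun[symmetric])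
  ultimately have "y 0 < a" "b < y 0" by auto
  then show False using assms(2)[of "y 0"] by simp
qed (simp_all add: lo hi)

text \<open>\<open>lo a\<close> is the least word of L if \<open>a\<close> is the least letter;
  otherwise its predecessor is the greatest word starting with the preceding letter.\<close>

lemma \<nu>_lo: "\<nu> (lo a) = right_copy Z (\<Sum>b\<in>{..<a}. letter_measure L \<mu> b)"
proof -
  have "(\<forall>y\<in>L. lex_le (lo a) y) \<or> (\<exists>u. consecutive L u (lo a))"
  proof (cases "{..<a} = {}")
    case True
    have "lex_le (lo a) y" if "y \<in> L" for y
    proof (cases "y 0 = a")
      case False
      moreover have "\<not> y 0 < a" using True by blast
      ultimately have "a < y 0" by simp
      then show ?thesis
        by (intro less_imp_lex_le first_less_imp_less) (simp add: lo)
    qed (simp add: lo that)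
    then show ?thesis by blast
  next
    case False
    then have "Max {..<a} < a" by (metis Max_in finite lessThan_iff)
    then have "consecutive L (hi (Max {..<a})) (lo a)"
      by (rule consecutive_hi_lo) (simp add: Max_ge)
    then show ?thesis by blast
  qed
  from \<nu>_right_copy[OF lo(1) this] show ?thesis by (simp add: R_lo)
qed

lemma \<nu>_hi: "\<nu> (hi a) = left_copy Z (\<Sum>b\<in>{..a}. letter_measure L \<mu> b)"
proof -
  have "(\<forall>y\<in>L. lex_le y (hi a)) \<or> (\<exists>u. consecutive L (hi a) u)"
  proof (cases "{a<..} = {}")
    case True
    have "lex_le y (hi a)" if "y \<in> L" for y
    proof (cases "y 0 = a")
      case False
      moreover have "\<not> a < y 0" using True by blast
      ultimately have "y 0 < a" by simp
      then show ?thesis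
        by (intro less_imp_lex_le first_less_imp_less) (simp add: hi)
    qed (simp add: hi that)
    then show ?thesis by blast
  next
    case False
    then have a: "a < Min {a<..}" by (metis Min_in finite greaterThan_iff)
    have "consecutive L (hi a) (lo (Min {a<..}))"
    proof (rule consecutive_hi_lo[OF a], rule ccontr)
      fix c assume c: "c < Min {a<..}" "\<not> c \<le> a"
      have "Min {a<..} \<le> c" using c(2) by (intro Min_le) auto
      then show False using c(1) leD by blast
    qed
    then show ?thesis by blast
  qed
  from \<nu>_left_copy[OF hi(1) this] show ?thesis by (simp add: R_hi)
qed

section \<open>Extreme words of the type intervals\<close>

lemma greatest_type:
  assumes "finite T" "T \<noteq> {}" "T \<subseteq> types \<phi>"
  shows "\<exists>t\<in>T. \<forall>s\<in>T. s = t \<or> (s, t) \<in> r"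
  using assms
proof (induction T rule: finite_ne_induct)
  case (insert s T)
  then obtain t where t: "t \<in> T" "\<forall>s\<in>T. s = t \<or> (s, t) \<in> r" by auto
  consider "(s, t) \<in> r \<or> s = t" | "(t, s) \<in> r"
    using r_total[of s t] insert.prems t(1) by blast
  then show ?case
  proof cases
    case 1
    then show ?thesis using t by blast
  next
    case 2
    then have "(t', s) \<in> r" if "t' \<in> T" for t'
      using t(2) that r_trans[of t' t s] by auto
    then show ?thesis by blast
  qed
qed simp

lemma least_type:
  assumes "finite T" "T \<noteq> {}" "T \<subseteq> types \<phi>"
  shows "\<exists>t\<in>T. \<forall>s\<in>T. s = t \<or> (t, s) \<in> r"
  using assms
proof (induction T rule: finite_ne_induct)
  case (insert s T)
  then obtain t where t: "t \<in> T" "\<forall>s\<in>T. s = t \<or> (t, s) \<in> r" by auto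
  consider "(t, s) \<in> r \<or> s = t" | "(s, t) \<in> r"
    using r_total[of s t] insert.prems t(1) by blast
  then show ?case
  proof cases
    case 1
    then show ?thesis using t by blast
  next
    case 2
    then have "(s, t') \<in> r" if "t' \<in> T" for t'
      using t(2) that r_trans[of s t t'] by auto
    then show ?thesis by blast
  qed
qed simp

text \<open>A word strictly between would have a type strictly between the two, since nothing of the
  first type exceeds the image of \<open>hi b\<close> and nothing of the second precedes that of
  \<open>lo c\<close>.\<close>

lemma consecutive_F_hi_lo:
  assumes "(b, p) \<in> types \<phi>" "(c, q) \<in> types \<phi>" "((b, p), (c, q)) \<in> r"
    and "\<And>t. t \<in> types \<phi> \<Longrightarrow> ((b, p), t) \<in> r \<Longrightarrow> (t, (c, q)) \<notin> r"
  shows "consecutive L (F p (hi b)) (F q (lo c))"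
  unfolding consecutive_def
proof (intro conjI notI)
  have p: "p < length (\<phi> [hi b 0])" "q < length (\<phi> [lo c 0])"
    using assms by (simp_all add: lo hi types_iff)
  show "less_fun (F p (hi b)) (F q (lo c))"
    using F_less_iff[OF hi(1) p(1) lo(1) p(2)] assms(3) by (simp add: lo hi)
  assume "\<exists>y\<in>L. less_fun (F p (hi b)) y \<and> less_fun y (F q (lo c))"
  then obtain y where y: "y \<in> L" "less_fun (F p (hi b)) y" "less_fun y (F q (lo c))" by blast
  obtain v s where v: "v \<in> L" "s < length (\<phi> [v 0])" "y = F s v" using decompose[OF y(1)] .
  have "((b, p), (v 0, s)) \<in> r \<or> b = v 0 \<and> p = s \<and> less_fun (hi b) v"
    using y(2) F_less_iff[OF hi(1) p(1) v(1,2)] v(3) by (simp add: hi)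
  then have "((b, p), (v 0, s)) \<in> r"
    using hi(3)[of v b] v(1) by (auto simp: not_less_fun[symmetric])
  moreover have "((v 0, s), (c, q)) \<in> r \<or> v 0 = c \<and> s = q \<and> less_fun v (lo c)"
    using y(3) F_less_iff[OF v(1,2) lo(1) p(2)] v(3) by (simp add: lo)
  then have "((v 0, s), (c, q)) \<in> r"
    using lo(3)[of v c] v(1) by (auto simp: not_less_fun[symmetric])
  ultimately show False using assms(4)[of "(v 0, s)"] v(2) by (simp add: types_iff)
qed (simp_all add: F_in_L lo hi)

lemma \<nu>_F_lo:
  assumes "p < length (\<phi> [a])"
  shows "\<nu> (F p (lo a)) =
    right_copy Z (\<Sum>t | t \<in> types \<phi> \<and> (t, (a, p)) \<in> r. type_length \<phi> L \<mu> t)"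
proof -
  let ?T = "{t. t \<in> types \<phi> \<and> (t, (a, p)) \<in> r}"
  have p: "p < length (\<phi> [lo a 0])" using assms by (simp add: lo)
  have "(\<forall>y\<in>L. lex_le (F p (lo a)) y) \<or> (\<exists>u. consecutive L u (F p (lo a)))"
  proof (cases "?T = {}")
    case True
    have "lex_le (F p (lo a)) y" if y: "y \<in> L" for y
    proof -
      obtain v s where v: "v \<in> L" "s < length (\<phi> [v 0])" "y = F s v" using decompose[OF y] .
      have "(v 0, s) = (a, p) \<or> ((a, p), (v 0, s)) \<in> r"
        using r_total[of "(v 0, s)" "(a, p)"] True v assms by (auto simp: types_iff)
      then show ?thesis
        using F_le_iff[OF lo(1) p v(1,2)] lo(3)[of v a] v by (auto simp: lo)
    qed
    then show ?thesis by blast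
  next
    case False
    have "finite ?T" using finite_types by simp
    then obtain t where t: "t \<in> ?T" "\<forall>s\<in>?T. s = t \<or> (s, t) \<in> r"
      using greatest_type[of ?T] False by auto
    have "consecutive L (F (snd t) (hi (fst t))) (F p (lo a))"
    proof (rule consecutive_F_hi_lo)
      fix s assume s: "s \<in> types \<phi>" "((fst t, snd t), s) \<in> r"
      show "(s, (a, p)) \<notin> r"
      proof
        assume "(s, (a, p)) \<in> r"
        then have "s = t \<or> (s, t) \<in> r" using t(2) s by blast
        then show False using s(2)[unfolded prod.collapse] r_asym r_irrefl by blast
      qed
    qed (use t assms in \<open>auto simp: types_iff\<close>)
    then show ?thesis by blast
  qed
  from \<nu>_right_copy[OF F_in_L[OF lo(1)] this]
  show ?thesis using R_F[OF lo(1) p] by (simp add: lo R_lo)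
qed

lemma R_F_hi:
  assumes "p < length (\<phi> [a])"
  shows "R (F p (hi a)) =
    (\<Sum>t | t \<in> types \<phi> \<and> ((t, (a, p)) \<in> r \<or> t = (a, p)). type_length \<phi> L \<mu> t)"
proof -
  let ?T = "{t. t \<in> types \<phi> \<and> (t, (a, p)) \<in> r}"
  have p: "p < length (\<phi> [hi a 0])" using assms by (simp add: hi)
  have "{t. t \<in> types \<phi> \<and> ((t, (a, p)) \<in> r \<or> t = (a, p))} = insert (a, p) ?T"
    using assms by (auto simp: types_iff)
  then have "(\<Sum>t | t \<in> types \<phi> \<and> ((t, (a, p)) \<in> r \<or> t = (a, p)). type_length \<phi> L \<mu> t) =
      type_length \<phi> L \<mu> (a, p) + (\<Sum>t\<in>?T. type_length \<phi> L \<mu> t)"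
    using finite_types r_irrefl by simp
  then show ?thesis
    using R_F[OF hi(1) p] R_hi_lo[of a] by (simp add: hi R_lo type_length_eq desubst_cyl)
qed

lemma \<nu>_F_hi:
  assumes "p < length (\<phi> [a])"
  shows "\<nu> (F p (hi a)) =
    left_copy Z (\<Sum>t | t \<in> types \<phi> \<and> ((t, (a, p)) \<in> r \<or> t = (a, p)). type_length \<phi> L \<mu> t)"
proof -
  let ?T = "{t. t \<in> types \<phi> \<and> ((a, p), t) \<in> r}"
  have p: "p < length (\<phi> [hi a 0])" using assms by (simp add: hi)
  have "(\<forall>y\<in>L. lex_le y (F p (hi a))) \<or> (\<exists>u. consecutive L (F p (hi a)) u)"
  proof (cases "?T = {}")
    case True
    have "lex_le y (F p (hi a))" if y: "y \<in> L" for y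
    proof -
      obtain v s where v: "v \<in> L" "s < length (\<phi> [v 0])" "y = F s v" using decompose[OF y] .
      have "(v 0, s) = (a, p) \<or> ((v 0, s), (a, p)) \<in> r"
        using r_total[of "(v 0, s)" "(a, p)"] True v assms by (auto simp: types_iff)
      then show ?thesis
        using F_le_iff[OF v(1,2) hi(1) p] hi(3)[of v a] v by (auto simp: hi)
    qed
    then show ?thesis by blast
  next
    case False
    have "finite ?T" using finite_types by simp
    then obtain t where t: "t \<in> ?T" "\<forall>s\<in>?T. s = t \<or> (t, s) \<in> r"
      using least_type[of ?T] False by auto
    have "consecutive L (F p (hi a)) (F (snd t) (lo (fst t)))"
    proof (rule consecutive_F_hi_lo)
      fix s assume s: "s \<in> types \<phi>" "((a, p), s) \<in> r"
      show "(s, (fst t, snd t)) \<notin> r"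
      proof
        assume "(s, (fst t, snd t)) \<in> r"
        then have "s = t \<or> (t, s) \<in> r" using t(2) s by blast
        then show False using \<open>(s, (fst t, snd t)) \<in> r\<close>[unfolded prod.collapse] r_asym r_irrefl by blast
      qed
    qed (use t assms in \<open>auto simp: types_iff\<close>)
    then show ?thesis by blast
  qed
  from \<nu>_left_copy[OF F_in_L[OF hi(1)] this]
  show ?thesis by (simp add: R_F_hi[OF assms])
qed

subsection \<open>The branches\<close>

text \<open>A successor of \<open>u\<close> is at most \<open>hi (u 0)\<close> and one of
  \<open>F p u\<close> is at most the image of that word, so both stay where \<open>F p\<close> is
  an order isomorphism onto a convex set. For \<open>u = hi (u 0)\<close> itself a successor starts
  with another letter.\<close>

lemma no_succ_F:
  assumes u: "u \<in> L" "u \<noteq> hi (u 0)" and p: "p < length (\<phi> [u 0])"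
  shows "no_succ (F p u) \<longleftrightarrow> no_succ u"
proof -
  have hi_u: "hi (u 0) \<in> L" "hi (u 0) 0 = u 0" "less_fun u (hi (u 0))"
    using u hi lex_le_def by metis+
  have "(\<exists>w. consecutive L u w) \<longleftrightarrow> (\<exists>y. consecutive L (F p u) y)"
  proof
    assume "\<exists>w. consecutive L u w"
    then obtain w where w: "w \<in> L" "less_fun u w" "\<not> (\<exists>y\<in>L. less_fun u y \<and> less_fun y w)"
      by (auto simp: consecutive_def)
    then have "lex_le w (hi (u 0))" using hi_u by (auto simp: not_less_fun[symmetric])
    then have "w 0 = u 0"
      using lex_le_first[of w "hi (u 0)"] lex_le_first[of u w] w(2) hi_u(2)
      by (simp add: less_imp_lex_le)
    then have p': "u 0 = w 0" "p < length (\<phi> [w 0])" using p by auto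
    have "consecutive L (F p u) (F p w)"
      unfolding consecutive_def
    proof (intro conjI notI)
      show "less_fun (F p u) (F p w)" using F_less_same[OF u(1) w(1) p'] w(2) by simp
      assume "\<exists>y\<in>L. less_fun (F p u) y \<and> less_fun y (F p w)"
      then obtain y where "y \<in> L" "less_fun (F p u) y" "less_fun y (F p w)" by blast
      from F_convex[OF u(1) w(1) p' this] show False using w(3) by metis
    qed (use u w in \<open>simp_all add: F_in_L\<close>)
    then show "\<exists>y. consecutive L (F p u) y" by blast
  next
    assume "\<exists>y. consecutive L (F p u) y"
    then obtain y where y: "y \<in> L" "less_fun (F p u) y"
      "\<not> (\<exists>z\<in>L. less_fun (F p u) z \<and> less_fun z y)"
      by (auto simp: consecutive_def)
    have p': "u 0 = hi (u 0) 0" "p < length (\<phi> [hi (u 0) 0])" using p hi_u(2) by auto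
    have "less_fun (F p u) (F p (hi (u 0)))" using F_less_same[OF u(1) hi_u(1) p'] hi_u(3) by simp
    then have le: "lex_le y (F p (hi (u 0)))"
      using y(3) F_in_L[OF hi_u(1)] by (auto simp: not_less_fun[symmetric])
    obtain w where w: "w \<in> L" "w 0 = u 0" "y = F p w" "less_fun u w"
    proof (cases "y = F p (hi (u 0))")
      case True
      then show ?thesis using that hi_u by blast
    next
      case False
      then have "less_fun y (F p (hi (u 0)))" using le by (simp add: lex_le_def)
      from F_convex[OF u(1) hi_u(1) p' y(1,2) this] show ?thesis using that hi_u(2) by metis
    qed
    have "consecutive L u w"
      unfolding consecutive_def
    proof (intro conjI notI)
      assume "\<exists>z\<in>L. less_fun u z \<and> less_fun z w"
      then obtain z where z: "z \<in> L" "less_fun u z" "less_fun z w" by blast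
      then have "z 0 = u 0"
        using lex_le_first[of u z] lex_le_first[of z w] w(2) by (simp add: less_imp_lex_le)
      then have "less_fun (F p u) (F p z)" "less_fun (F p z) y"
        using F_less_same[of u z p] F_less_same[of z w p] u w z p by simp_all
      then show False using y(3) F_in_L[OF z(1)] by blast
    qed (use u w in auto)
    then show "\<exists>w. consecutive L u w" by blast
  qed
  then show ?thesis by (simp add: no_succ_def)
qed

lemma no_pred_F:
  assumes u: "u \<in> L" "u \<noteq> lo (u 0)" and p: "p < length (\<phi> [u 0])"
  shows "no_pred (F p u) \<longleftrightarrow> no_pred u"
proof -
  have lo_u: "lo (u 0) \<in> L" "lo (u 0) 0 = u 0" "less_fun (lo (u 0)) u"
    using u lo lex_le_def by metis+
  have "(\<exists>w. consecutive L w u) \<longleftrightarrow> (\<exists>y. consecutive L y (F p u))"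
  proof
    assume "\<exists>w. consecutive L w u"
    then obtain w where w: "w \<in> L" "less_fun w u" "\<not> (\<exists>y\<in>L. less_fun w y \<and> less_fun y u)"
      by (auto simp: consecutive_def)
    then have "lex_le (lo (u 0)) w" using lo_u by (auto simp: not_less_fun[symmetric])
    then have p': "w 0 = u 0"
      using lex_le_first[of "lo (u 0)" w] lex_le_first[of w u] w(2) lo_u(2)
      by (simp add: less_imp_lex_le)
    have "consecutive L (F p w) (F p u)"
      unfolding consecutive_def
    proof (intro conjI notI)
      show "less_fun (F p w) (F p u)" using F_less_same[OF w(1) u(1) p' p] w(2) by simp
      assume "\<exists>y\<in>L. less_fun (F p w) y \<and> less_fun y (F p u)"
      then obtain y where "y \<in> L" "less_fun (F p w) y" "less_fun y (F p u)" by blast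
      from F_convex[OF w(1) u(1) p' p this] show False using w(3) by metis
    qed (use u w in \<open>simp_all add: F_in_L\<close>)
    then show "\<exists>y. consecutive L y (F p u)" by blast
  next
    assume "\<exists>y. consecutive L y (F p u)"
    then obtain y where y: "y \<in> L" "less_fun y (F p u)"
      "\<not> (\<exists>z\<in>L. less_fun y z \<and> less_fun z (F p u))"
      by (auto simp: consecutive_def)
    have "less_fun (F p (lo (u 0))) (F p u)"
      using F_less_same[OF lo_u(1) u(1) lo_u(2) p] lo_u(3) by simp
    then have le: "lex_le (F p (lo (u 0))) y"
      using y(3) F_in_L[OF lo_u(1)] by (auto simp: not_less_fun[symmetric])
    obtain w where w: "w \<in> L" "w 0 = u 0" "y = F p w" "less_fun w u"
    proof (cases "y = F p (lo (u 0))")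
      case True
      then show ?thesis using that lo_u by blast
    next
      case False
      then have "less_fun (F p (lo (u 0))) y" using le by (simp add: lex_le_def)
      from F_convex[OF lo_u(1) u(1) lo_u(2) p y(1) this y(2)] show ?thesis using that by metis
    qed
    have "consecutive L w u"
      unfolding consecutive_def
    proof (intro conjI notI)
      assume "\<exists>z\<in>L. less_fun w z \<and> less_fun z u"
      then obtain z where z: "z \<in> L" "less_fun w z" "less_fun z u" by blast
      then have "z 0 = u 0"
        using lex_le_first[of w z] lex_le_first[of z u] w(2) by (simp add: less_imp_lex_le)
      then have "less_fun (F p z) (F p u)" "less_fun y (F p z)"
        using F_less_same[of z u p] F_less_same[of w z p] u w z p by simp_all
      then show False using y(3) F_in_L[OF z(1)] by blast
    qed (use u w in auto)
    then show "\<exists>w. consecutive L w u" by blast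
  qed
  then show ?thesis by (simp add: no_pred_def)
qed

lemma branch_\<nu>:
  assumes u: "u \<in> L" and p: "p < length (\<phi> [u 0])"
  shows "branch \<phi> L \<mu> r (u 0) p (\<nu> u) = \<nu> (F p u)"
proof -
  let ?a = "u 0"
  define x\<^sub>1 x\<^sub>2 where "x\<^sub>1 = (\<Sum>b\<in>{..<?a}. letter_measure L \<mu> b)"
    and "x\<^sub>2 = (\<Sum>b\<in>{..?a}. letter_measure L \<mu> b)"
  define y\<^sub>1 y\<^sub>2 where "y\<^sub>1 = (\<Sum>t\<in>{t \<in> types \<phi>. (t, (?a, p)) \<in> r}. type_length \<phi> L \<mu> t)"
    and "y\<^sub>2 = (\<Sum>t\<in>{t \<in> types \<phi>. (t, (?a, p)) \<in> r \<or> t = (?a, p)}. type_length \<phi> L \<mu> t)"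
  define g where "g x = (y\<^sub>2 - y\<^sub>1) / (x\<^sub>2 - x\<^sub>1) * (x - x\<^sub>1) + y\<^sub>1" for x
  have branch: "branch \<phi> L \<mu> r ?a p s =
      (if s = right_copy Z x\<^sub>1 then right_copy Z y\<^sub>1
       else if s = left_copy Z x\<^sub>2 then left_copy Z y\<^sub>2
       else (case s of Minus x \<Rightarrow> Minus (g x) | Plain x \<Rightarrow> Plain (g x) | Plus x \<Rightarrow> Plus (g x)))" for s
    unfolding branch_def Let_def x\<^sub>1_def x\<^sub>2_def y\<^sub>1_def y\<^sub>2_def g_def by (rule refl)
  have lo_eq: "\<nu> (lo ?a) = right_copy Z x\<^sub>1" "\<nu> (F p (lo ?a)) = right_copy Z y\<^sub>1"
    using \<nu>_lo \<nu>_F_lo[OF p] by (simp_all add: x\<^sub>1_def y\<^sub>1_def)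
  have hi_eq: "\<nu> (hi ?a) = left_copy Z x\<^sub>2" "\<nu> (F p (hi ?a)) = left_copy Z y\<^sub>2"
    using \<nu>_hi \<nu>_F_hi[OF p] by (simp_all add: x\<^sub>2_def y\<^sub>2_def)
  have x12: "x\<^sub>2 - x\<^sub>1 = m (cyl ?a)" using R_hi_lo[of ?a] by (simp add: R_hi R_lo x\<^sub>1_def x\<^sub>2_def)
  have "R (F p (hi ?a)) = y\<^sub>1 + \<kappa> * (x\<^sub>2 - x\<^sub>1)"
    using R_F[OF hi(1), of p ?a] p by (simp add: hi R_hi x\<^sub>1_def x\<^sub>2_def y\<^sub>1_def)
  then have "y\<^sub>2 - y\<^sub>1 = \<kappa> * (x\<^sub>2 - x\<^sub>1)" using R_F_hi[OF p] by (simp add: y\<^sub>2_def)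
  \<comment> \<open>The slope of g is \<kappa>, and the division is legitimate as x2 - x1 is the
    positive mass of a cylinder.\<close>
  then have g: "g (R u) = R (F p u)"
    using R_F[OF u p] x12 cyl_pos[of ?a] by (simp add: g_def x\<^sub>1_def y\<^sub>1_def)
  \<comment> \<open>\<open>branch\<close> tests the lower endpoint before the upper one, so the
    second case must exclude it; injectivity of \<nu> provides this.\<close>
  consider "u = lo ?a" | "u = hi ?a" "\<nu> u \<noteq> right_copy Z x\<^sub>1" | "u \<noteq> lo ?a" "u \<noteq> hi ?a"
    using lo_eq(1) \<nu>_inj[OF u lo(1)] by metis
  then show ?thesis
  proof cases
    case 1
    then have "\<nu> u = right_copy Z x\<^sub>1" "\<nu> (F p u) = right_copy Z y\<^sub>1" using lo_eq by metis+
    then show ?thesis by (simp add: branch)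
  next
    case 2
    then have "\<nu> u = left_copy Z x\<^sub>2" "\<nu> (F p u) = left_copy Z y\<^sub>2" using hi_eq by metis+
    then show ?thesis using 2(2) by (simp add: branch)
  next
    case 3
    have "\<nu> u \<noteq> right_copy Z x\<^sub>1" using \<nu>_inj[OF u lo(1)] 3(1) lo_eq(1) by metis
    moreover have "\<nu> u \<noteq> left_copy Z x\<^sub>2" using \<nu>_inj[OF u hi(1)] 3(2) hi_eq(1) by metis
    moreover have "no_succ (F p u) \<longleftrightarrow> no_succ u" "no_pred (F p u) \<longleftrightarrow> no_pred u"
      using no_succ_F[OF u 3(2) p] no_pred_F[OF u 3(1) p] by auto
    ultimately show ?thesis
      unfolding branch by (auto simp: nu_def no_succ_def no_pred_def g)
  qed
qed

text \<open>The endpoints are the values at \<open>lo a\<close> and \<open>hi a\<close>, so by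
  strict monotonicity membership says that the word lies between them, which determines its first
  letter.\<close>

lemma letter_interval_\<nu>:
  assumes u: "u \<in> L"
  shows "(THE a. \<nu> u \<in> letter_interval L \<mu> a) = u 0"
proof -
  have iff: "\<nu> u \<in> letter_interval L \<mu> a \<longleftrightarrow> \<nu> (lo a) \<le> \<nu> u \<and> \<nu> u \<le> \<nu> (hi a)" for a
    using \<nu>_in_ext_interval[OF u] by (simp add: letter_interval_def Let_def \<nu>_lo \<nu>_hi)
  show ?thesis
  proof (rule the_equality)
    show "\<nu> u \<in> letter_interval L \<mu> (u 0)"
      unfolding iff using u lo hi by (auto intro!: \<nu>_mono)
    fix a assume "\<nu> u \<in> letter_interval L \<mu> a"
    then have "\<not> less_fun u (lo a)" "\<not> less_fun (hi a) u"
      unfolding iff using \<nu>_strict_mono[OF u lo(1), of a] \<nu>_strict_mono[OF hi(1) u, of a] by auto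
    then have "a \<le> u 0" "u 0 \<le> a"
      using lex_le_first[of "lo a" u] lex_le_first[of u "hi a"] lo(2)[of a] hi(2)[of a]
      by (simp_all add: not_less_fun)
    then show "a = u 0" by simp
  qed
qed

section \<open>From single points to sequences\<close>

lemma morphism_ext_morphism: "morphism (ext_morphism \<phi> L \<mu> r)"
  by (simp add: morphism_def ext_morphism_def)

lemma ext_morphism_\<nu>:
  assumes "u \<in> L"
  shows "ext_morphism \<phi> L \<mu> r [\<nu> u] = map (\<lambda>p. \<nu> (F p u)) [0..<length (\<phi> [u 0])]"
  using assms by (simp add: ext_morphism_def letter_interval_\<nu> branch_\<nu> Let_def)

text \<open>The block produced by the k-th point consists of the values at \<open>F p\<close> of the
  k-th shift of \<open>w\<close>. These words are the shifts of \<phi>(w) by l + p, where l is the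
  length of the image of the first k letters, so the blocks join without gaps.\<close>

lemma ext_morphism_prefix:
  assumes w: "w \<in> L"
  shows "ext_morphism \<phi> L \<mu> r (map (nu_word L \<mu> w) [0..<k]) =
    map (nu_word L \<mu> (\<Phi> w)) [0..<length (\<phi> (map w [0..<k]))]"
proof (induction k)
  case 0
  then show ?case by (simp add: morphism_Nil[OF hom] ext_morphism_def)
next
  case (Suc k)
  let ?l = "length (\<phi> (map w [0..<k]))" and ?u = "(shift ^^ k) w"
  have u: "?u \<in> L" "?u 0 = w k" using w by (simp_all add: shift_funpow_in_L) (simp add: shift_funpow)
  have "F p ?u = (shift ^^ (?l + p)) (\<Phi> w)" for p
  proof -
    have "F p ?u = (shift ^^ p) ((shift ^^ ?l) (\<Phi> w))" by (simp only: F_def \<Phi>_shift)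
    then show ?thesis by (simp add: shift_funpow add.assoc)
  qed
  then have "ext_morphism \<phi> L \<mu> r [nu_word L \<mu> w k] =
      map (\<lambda>p. nu_word L \<mu> (\<Phi> w) (?l + p)) [0..<length (\<phi> [w k])]"
    using ext_morphism_\<nu>[OF u(1)] u(2) by (simp add: nu_word_def)
  moreover have "map f [0..<?l + c] = map f [0..<?l] @ map (\<lambda>p. f (?l + p)) [0..<c]"
    for f :: "nat \<Rightarrow> xreal" and c
    by (induction c) auto
  ultimately show ?case
    by (simp only: morphism_prefix_Suc[OF morphism_ext_morphism] morphism_prefix_Suc[OF hom] Suc
        length_append)
qed

lemma inf_image_ext_morphism:
  assumes w: "w \<in> L"
  shows "inf_image (ext_morphism \<phi> L \<mu> r) (nu_word L \<mu> w) = nu_word L \<mu> (\<Phi> w)"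
proof
  fix n
  have "n < length (\<phi> (map w [0..<Suc n]))" using length_image_prefix[of "Suc n" w] by linarith
  then show "inf_image (ext_morphism \<phi> L \<mu> r) (nu_word L \<mu> w) n = nu_word L \<mu> (\<Phi> w) n"
    using inf_image_nth[OF morphism_ext_morphism, of n "nu_word L \<mu> w" "Suc n"]
    unfolding ext_morphism_prefix[OF w] by simp
qed

end

theorem theorem1:
  fixes \<phi> :: "'a::{finite,linorder} list \<Rightarrow> 'a list"
    and x w :: "nat \<Rightarrow> 'a"
    and L :: "(nat \<Rightarrow> 'a) set"
    and \<mu> :: "(nat \<Rightarrow> 'a) measure"
    and r :: "('a \<times> nat) rel"
  assumes "primitive_morphism \<phi>"
    and "inf_image \<phi> x = x" and "aperiodic x"
    and "L = orbit_closure x"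
    and "invariant_prob L \<mu>"
    and "separable \<phi> L" and "type_order \<phi> L r"
    and "order_preserving_on L \<phi>"
    and "w \<in> L"
  shows "inf_image (ext_morphism \<phi> L \<mu> r) (nu_word L \<mu> w) = nu_word L \<mu> (inf_image \<phi> w)"
proof -
  interpret measured_separable_substitution \<phi> x L r \<mu>
    using assms by unfold_locales
  show ?thesis by (rule inf_image_ext_morphism[OF \<open>w \<in> L\<close>])
qed

end
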